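(* Let $p\ge2$ be an integer. The tensor product shift $\alpha$ on the UHF $C^*$-algebra $M_p^{\otimes\mathbb{Z}}$ has infinite CA entropy: $\mathrm{hc}(\alpha)=\infty$.
   Context: $M_p$ is the $C^*$-algebra of $p\times p$ complex matrices, $M_p^{\otimes\mathbb{Z}}$ is the infinite $C^*$-tensor product of copies of $M_p$ indexed by $\mathbb{Z}$, and the tensor product shift is the $^*$-automorphism induced by the shift $k\mapsto k+1$ on the index set $\mathbb{Z}$. CA entropy: For a bounded linear map $\gamma:X\to Y$ of (complex) Banach spaces, a finite set $\Omega\subseteq X$ and $\delta>0$, let $\mathrm{CA}(\gamma,\Omega,\delta)$ be the collection of triples $(\phi,\psi,d)$ where $d$ is a positive integer and $\phi:X\to\ell_\infty^d$, $\psi:\ell_\infty^d\to Y$ are contractive (norm $\le1$) linear maps with $\|\psi\circ\phi(x)-\gamma(x)\|<\delta$ for all $x\in\Omega$. A CA embedding of $X$ is an isometric linear map $\iota$ from $X$ into a Banach space $Y$ such that $\mathrm{CA}(\iota,\Omega,\delta)\neq\emptyset$ for all finite $\Omega\subseteq X$ and $\delta>0$; every Banach space has one (e.g. the evaluation map $X\to C(B_1(X^* ))$, where $B_1(X^* )$ is the weak$^*$ compact unit ball of the dual). Set $\mathrm{rc}(\Omega,\delta)=\inf\{d:(\phi,\psi,d)\in\mathrm{CA}(\iota,\Omega,\delta)\}$, which does not depend on the CA embedding $\iota$. For an isometric (surjective linear) automorphism $\alpha$ of $X$ put $\mathrm{hc}(\alpha,\Omega,\delta)=\limsup_{n\to\infty}\frac1n\log\mathrm{rc}(\Omega\cup\alpha\Omega\cup\cdots\cup\alpha^{n-1}\Omega,\delta)$,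 $\mathrm{hc}(\alpha,\Omega)=\sup_{\delta>0}\mathrm{hc}(\alpha,\Omega,\delta)$, and $\mathrm{hc}(\alpha)=\sup_\Omega\mathrm{hc}(\alpha,\Omega)$ over finite $\Omega\subseteq X$. For a $^*$-automorphism of a $C^*$-algebra, $\mathrm{hc}$ is computed by viewing it as an isometric automorphism of the underlying Banach space. *)

theory Defs
  imports "HOL-Analysis.Analysis" "HOL-Probability.Discrete_Topology"
begin

section \<open>Complex normed spaces and C*-algebras\<close>

class scaleC = scaleR +
  fixes scaleC :: "complex \<Rightarrow> 'a \<Rightarrow> 'a"  (infixr \<open>*\<^sub>C\<close> 75)
  assumes scaleR_scaleC: "r *\<^sub>R x = complex_of_real r *\<^sub>C x"

class complex_normed_vector = real_normed_vector + scaleC +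
  assumes scaleC_add_right: "a *\<^sub>C (x + y) = a *\<^sub>C x + a *\<^sub>C y"
    and scaleC_add_left: "(a + b) *\<^sub>C x = a *\<^sub>C x + b *\<^sub>C x"
    and scaleC_scaleC: "a *\<^sub>C b *\<^sub>C x = (a * b) *\<^sub>C x"
    and norm_scaleC: "norm (a *\<^sub>C x) = cmod a * norm x"

class complex_banach = complex_normed_vector + complete_space

subclass (in complex_banach) banach ..

class pre_cstar_algebra = complex_normed_vector + real_normed_algebra_1 +
  fixes star :: "'a \<Rightarrow> 'a"
  assumes mult_scaleC_left: "(a *\<^sub>C x) * y = a *\<^sub>C (x * y)"
    and mult_scaleC_right: "x * (a *\<^sub>C y) = a *\<^sub>C (x * y)"
    and star_star: "star (star x) = x"
    and star_add: "star (x + y) = star x + star y"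
    and star_scaleC: "star (a *\<^sub>C x) = cnj a *\<^sub>C star x"
    and star_mult: "star (x * y) = star y * star x"
    and cstar_identity: "norm (star x * x) = (norm x)\<^sup>2"

class cstar_algebra = pre_cstar_algebra + complex_banach

definition clinear :: "('a::complex_normed_vector \<Rightarrow> 'b::complex_normed_vector) \<Rightarrow> bool" where
  "clinear f \<longleftrightarrow> (\<forall>x y. f (x + y) = f x + f y) \<and> (\<forall>c x. f (c *\<^sub>C x) = c *\<^sub>C f x)"

definition isometric :: "('a::real_normed_vector \<Rightarrow> 'b::real_normed_vector) \<Rightarrow> bool" where
  "isometric f \<longleftrightarrow> (\<forall>x. norm (f x) = norm x)"

definition isometric_automorphism :: "('a::complex_normed_vector \<Rightarrow> 'a) \<Rightarrow> bool" where
  "isometric_automorphism \<alpha> \<longleftrightarrow> clinear \<alpha> \<and> isometric \<alpha> \<and> surj \<alpha>"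

definition star_automorphism :: "('a::cstar_algebra \<Rightarrow> 'a) \<Rightarrow> bool" where
  "star_automorphism \<alpha> \<longleftrightarrow> clinear \<alpha> \<and> bij \<alpha> \<and> \<alpha> 1 = 1
     \<and> (\<forall>x y. \<alpha> (x * y) = \<alpha> x * \<alpha> y) \<and> (\<forall>x. \<alpha> (star x) = star (\<alpha> x))"

lemma star_minus: "star (- x) = - star (x :: 'a::pre_cstar_algebra)"
proof -
  have "star (- x) + star x = star 0" by (simp flip: star_add)
  moreover have "star (0::'a) = 0"
    using star_add[of "0::'a" 0] by simp
  ultimately show ?thesis by (simp add: eq_neg_iff_add_eq_0)
qed

lemma star_diff: "star (x - y) = star x - star (y :: 'a::pre_cstar_algebra)"
  using star_add[of x "- y"] by (simp add: star_minus)

lemma norm_star: "norm (star x) = norm (x :: 'a::pre_cstar_algebra)"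
proof -
  have *: "norm y \<le> norm (star y)" for y :: 'a
  proof (cases "y = 0")
    case False
    have "norm y * norm y \<le> norm (star y) * norm y"
      using cstar_identity[of y] norm_mult_ineq[of "star y" y] by (simp add: power2_eq_square)
    with False show ?thesis by simp
  qed simp
  from *[of x] *[of "star x"] show ?thesis by (simp add: star_star)
qed

section \<open>CA entropy\<close>

text \<open>
  The dimension \<open>d\<close> is quantified, so the \<open>d\<close>-dimensional \<open>\<ell>\<^sub>\<infinity>\<close> is the space \<open>linf d\<close> of functions on \<open>nat\<close> that vanish off
  \<open>{..<d}\<close>, with pointwise operations.
\<close>

definition linf :: "nat \<Rightarrow> (nat \<Rightarrow> complex) set" where
  "linf d = {v. \<forall>i\<ge>d. v i = 0}"

definition linf_norm :: "nat \<Rightarrow> (nat \<Rightarrow> complex) \<Rightarrow> real" where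
  "linf_norm d v = Max ((\<lambda>i. cmod (v i)) ` {..<d})"

definition contraction_to_linf :: "nat \<Rightarrow> ('a::complex_normed_vector \<Rightarrow> nat \<Rightarrow> complex) \<Rightarrow> bool" where
  "contraction_to_linf d \<phi> \<longleftrightarrow>
     (\<forall>x. \<phi> x \<in> linf d)
   \<and> (\<forall>x y. \<phi> (x + y) = (\<lambda>i. \<phi> x i + \<phi> y i))
   \<and> (\<forall>c x. \<phi> (c *\<^sub>C x) = (\<lambda>i. c * \<phi> x i))
   \<and> (\<forall>x. linf_norm d (\<phi> x) \<le> norm x)"

definition contraction_from_linf :: "nat \<Rightarrow> ((nat \<Rightarrow> complex) \<Rightarrow> 'b::complex_normed_vector) \<Rightarrow> bool" where
  "contraction_from_linf d \<psi> \<longleftrightarrow>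
     (\<forall>v\<in>linf d. \<forall>w\<in>linf d. \<psi> (\<lambda>i. v i + w i) = \<psi> v + \<psi> w)
   \<and> (\<forall>c. \<forall>v\<in>linf d. \<psi> (\<lambda>i. c * v i) = c *\<^sub>C \<psi> v)
   \<and> (\<forall>v\<in>linf d. norm (\<psi> v) \<le> linf_norm d v)"

definition CA :: "('a::complex_normed_vector \<Rightarrow> 'b::complex_normed_vector) \<Rightarrow> 'a set \<Rightarrow> real
    \<Rightarrow> (('a \<Rightarrow> nat \<Rightarrow> complex) \<times> ((nat \<Rightarrow> complex) \<Rightarrow> 'b) \<times> nat) set" where
  "CA \<gamma> \<Omega> \<delta> = {(\<phi>, \<psi>, d). d > 0 \<and> contraction_to_linf d \<phi> \<and> contraction_from_linf d \<psi>
     \<and> (\<forall>x\<in>\<Omega>. norm (\<psi> (\<phi> x) - \<gamma> x) < \<delta>)}"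

definition CA_embedding :: "('a::complex_banach \<Rightarrow> 'b::complex_banach) \<Rightarrow> bool" where
  "CA_embedding \<iota> \<longleftrightarrow> clinear \<iota> \<and> isometric \<iota> \<and> (\<forall>\<Omega> \<delta>. finite \<Omega> \<longrightarrow> \<delta> > 0 \<longrightarrow> CA \<iota> \<Omega> \<delta> \<noteq> {})"

text \<open>
  The value of \<open>rc\<close> does not depend on the CA embedding \<open>\<iota>\<close>. Its target is an arbitrary type, so
  \<open>\<iota>\<close> cannot be quantified inside the definition and is a parameter here. For a CA embedding the
  infimum, taken in \<open>nat\<close>, is over a nonempty set of positive integers.
\<close>

definition rc :: "('a::complex_banach \<Rightarrow> 'b::complex_banach) \<Rightarrow> 'a set \<Rightarrow> real \<Rightarrow> nat" where
  "rc \<iota> \<Omega> \<delta> = (INF (\<phi>, \<psi>, d) \<in> CA \<iota> \<Omega> \<delta>. d)"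

definition hc_at :: "('a::complex_banach \<Rightarrow> 'b::complex_banach) \<Rightarrow> ('a \<Rightarrow> 'a) \<Rightarrow> 'a set \<Rightarrow> real \<Rightarrow> ereal" where
  "hc_at \<iota> \<alpha> \<Omega> \<delta> =
     limsup (\<lambda>n. ereal (1 / real n * ln (real (rc \<iota> (\<Union>k<n. (\<alpha> ^^ k) ` \<Omega>) \<delta>))))"

definition hc :: "('a::complex_banach \<Rightarrow> 'b::complex_banach) \<Rightarrow> ('a \<Rightarrow> 'a) \<Rightarrow> ereal" where
  "hc \<iota> \<alpha> = (SUP \<Omega> \<in> {\<Omega>. finite \<Omega>}. SUP \<delta> \<in> {0<..}. hc_at \<iota> \<alpha> \<Omega> \<delta>)"

section \<open>Completion of a normed *-algebra satisfying the C*-identity\<close>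

text \<open>
  The C*-algebra of Cauchy sequences modulo null sequences, with pointwise operations.
\<close>

definition cauchy_rel :: "(nat \<Rightarrow> 'a::real_normed_vector) \<Rightarrow> (nat \<Rightarrow> 'a) \<Rightarrow> bool" where
  "cauchy_rel X Y \<longleftrightarrow> Cauchy X \<and> Cauchy Y \<and> (\<lambda>n. X n - Y n) \<longlonglongrightarrow> 0"

lemma part_equivp_cauchy_rel: "part_equivp (cauchy_rel :: (nat \<Rightarrow> 'a::real_normed_vector) \<Rightarrow> _)"
proof (rule part_equivpI)
  show "\<exists>X::nat \<Rightarrow> 'a. cauchy_rel X X"
    by (rule exI[of _ "\<lambda>_. 0"]) (simp add: cauchy_rel_def convergent_Cauchy convergent_const)
  show "symp (cauchy_rel :: (nat \<Rightarrow> 'a) \<Rightarrow> _)"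
  proof (rule sympI)
    fix X Y :: "nat \<Rightarrow> 'a"
    assume "cauchy_rel X Y"
    then show "cauchy_rel Y X"
      unfolding cauchy_rel_def using tendsto_minus[of "\<lambda>n. X n - Y n" 0 sequentially] by simp
  qed
  show "transp (cauchy_rel :: (nat \<Rightarrow> 'a) \<Rightarrow> _)"
  proof (rule transpI)
    fix X Y Z :: "nat \<Rightarrow> 'a"
    assume "cauchy_rel X Y" "cauchy_rel Y Z"
    then show "cauchy_rel X Z"
      unfolding cauchy_rel_def
      using tendsto_add[of "\<lambda>n. X n - Y n" 0 sequentially "\<lambda>n. Y n - Z n" 0] by simp
  qed
qed

quotient_type (overloaded) 'a completion = "nat \<Rightarrow> 'a::pre_cstar_algebra" / partial: cauchy_rel
  by (rule part_equivp_cauchy_rel)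

lemma scaleC_zero_left [simp]: "0 *\<^sub>C x = (0 :: 'a::complex_normed_vector)"
  and scaleC_zero_right [simp]: "c *\<^sub>C (0 :: 'a::complex_normed_vector) = 0"
  using norm_scaleC[of 0 x] norm_scaleC[of c 0] by simp_all

lemma scaleC_one [simp]: "1 *\<^sub>C x = (x :: 'a::complex_normed_vector)"
  using scaleR_scaleC[of 1 x] by simp

lemma bounded_linear_scaleC: "bounded_linear (\<lambda>x::'a::complex_normed_vector. c *\<^sub>C x)"
  by (rule bounded_linear_intro[of _ "cmod c"])
     (simp_all add: scaleC_add_right scaleR_scaleC scaleC_scaleC mult.commute norm_scaleC)

lemma clinear_imp_bounded_linear:
  fixes f :: "'a::complex_normed_vector \<Rightarrow> 'b::complex_normed_vector"
  assumes "clinear f" "\<And>x. norm (f x) \<le> K * norm x"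
  shows "bounded_linear f"
  by (rule bounded_linear_intro[of _ K])
     (use assms in \<open>simp_all add: clinear_def scaleR_scaleC mult.commute\<close>)

lemma bounded_linear_star: "bounded_linear (star :: 'a::pre_cstar_algebra \<Rightarrow> 'a)"
  by (rule bounded_linear_intro[of _ 1])
     (simp_all add: star_add scaleR_scaleC star_scaleC norm_star)

lemma Cauchy_add:
  fixes X Y :: "nat \<Rightarrow> 'a::real_normed_vector"
  assumes "Cauchy X" "Cauchy Y"
  shows "Cauchy (\<lambda>n. X n + Y n)"
proof (rule CauchyI)
  fix e :: real assume "0 < e"
  then obtain M N where M: "\<And>m n. m \<ge> M \<Longrightarrow> n \<ge> M \<Longrightarrow> norm (X m - X n) < e / 2"
    and N: "\<And>m n. m \<ge> N \<Longrightarrow> n \<ge> N \<Longrightarrow> norm (Y m - Y n) < e / 2"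
    using assms by (meson CauchyD half_gt_zero)
  have "norm (X m + Y m - (X n + Y n)) < e" if "m \<ge> max M N" "n \<ge> max M N" for m n
    using M[of m n] N[of m n] that norm_triangle_ineq[of "X m - X n" "Y m - Y n"]
    by (simp add: algebra_simps)
  then show "\<exists>M. \<forall>m\<ge>M. \<forall>n\<ge>M. norm (X m + Y m - (X n + Y n)) < e" by blast
qed

lemma Cauchy_mult:
  fixes X Y :: "nat \<Rightarrow> 'a::real_normed_algebra"
  assumes "Cauchy X" "Cauchy Y"
  shows "Cauchy (\<lambda>n. X n * Y n)"
proof (rule CauchyI)
  fix e :: real assume "0 < e"
  obtain A where A: "A > 0" "\<And>n. norm (X n) \<le> A"
    using Cauchy_Bseq[OF assms(1)] by (auto simp: Bseq_def)
  obtain B where B: "B > 0" "\<And>n. norm (Y n) \<le> B"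
    using Cauchy_Bseq[OF assms(2)] by (auto simp: Bseq_def)
  from \<open>0 < e\<close> A B have "0 < e / (2 * A)" "0 < e / (2 * B)" by simp_all
  then obtain M N where M: "\<And>m n. m \<ge> M \<Longrightarrow> n \<ge> M \<Longrightarrow> norm (X m - X n) < e / (2 * B)"
    and N: "\<And>m n. m \<ge> N \<Longrightarrow> n \<ge> N \<Longrightarrow> norm (Y m - Y n) < e / (2 * A)"
    using assms by (meson CauchyD)
  have "norm (X m * Y m - X n * Y n) < e" if "m \<ge> max M N" "n \<ge> max M N" for m n
  proof -
    have "X m * Y m - X n * Y n = X m * (Y m - Y n) + (X m - X n) * Y n"
      by (simp add: algebra_simps)
    then have "norm (X m * Y m - X n * Y n)
        \<le> norm (X m) * norm (Y m - Y n) + norm (X m - X n) * norm (Y n)"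
      by (metis (no_types) norm_triangle_le add_mono norm_mult_ineq)
    also have "norm (X m) * norm (Y m - Y n) \<le> A * norm (Y m - Y n)"
      using A by (intro mult_right_mono) auto
    also have "A * norm (Y m - Y n) < A * (e / (2 * A))"
      using A N[of m n] that by (intro mult_strict_left_mono) auto
    also have "norm (X m - X n) * norm (Y n) \<le> norm (X m - X n) * B"
      using B by (intro mult_left_mono) auto
    also have "norm (X m - X n) * B \<le> e / (2 * B) * B"
      using B M[of m n] that by (intro mult_right_mono) auto
    finally show ?thesis using A(1) B(1) by simp
  qed
  then show "\<exists>M. \<forall>m\<ge>M. \<forall>n\<ge>M. norm (X m * Y m - X n * Y n) < e" by blast
qed

lemma Cauchy_norm:
  fixes X :: "nat \<Rightarrow> 'a::real_normed_vector"
  assumes "Cauchy X"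
  shows "convergent (\<lambda>n. norm (X n))"
proof -
  have "Cauchy (\<lambda>n. norm (X n))"
  proof (rule CauchyI)
    fix e :: real assume "0 < e"
    then obtain M where "\<And>m n. m \<ge> M \<Longrightarrow> n \<ge> M \<Longrightarrow> norm (X m - X n) < e"
      using assms by (meson CauchyD)
    then show "\<exists>M. \<forall>m\<ge>M. \<forall>n\<ge>M. norm (norm (X m) - norm (X n)) < e"
      by (metis norm_triangle_ineq3 le_less_trans real_norm_def)
  qed
  then show ?thesis by (simp add: Cauchy_convergent_iff)
qed

lemma cauchy_rel_refl [simp]: "cauchy_rel X X \<longleftrightarrow> Cauchy X"
  by (simp add: cauchy_rel_def)

lemma cauchy_rel_bounded_linear:
  assumes "bounded_linear f" "cauchy_rel X Y"
  shows "cauchy_rel (\<lambda>n. f (X n)) (\<lambda>n. f (Y n))"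
proof -
  interpret bounded_linear f by fact
  show ?thesis
    using assms(2) Cauchy tendsto_zero[of "\<lambda>n. X n - Y n"] by (auto simp: cauchy_rel_def diff)
qed

lemma cauchy_rel_add:
  assumes "cauchy_rel X X'" "cauchy_rel Y Y'"
  shows "cauchy_rel (\<lambda>n. X n + Y n) (\<lambda>n. X' n + Y' n)"
  using assms tendsto_add[of "\<lambda>n. X n - X' n" 0 sequentially "\<lambda>n. Y n - Y' n" 0]
  by (simp add: cauchy_rel_def Cauchy_add algebra_simps)

lemma cauchy_rel_mult:
  fixes X :: "nat \<Rightarrow> 'a::real_normed_algebra"
  assumes "cauchy_rel X X'" "cauchy_rel Y Y'"
  shows "cauchy_rel (\<lambda>n. X n * Y n) (\<lambda>n. X' n * Y' n)"
proof -
  from assms have C: "Cauchy X" "Cauchy X'" "Cauchy Y" "Cauchy Y'"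
    and Z: "Zfun (\<lambda>n. X n - X' n) sequentially" "Zfun (\<lambda>n. Y n - Y' n) sequentially"
    by (auto simp: cauchy_rel_def tendsto_Zfun_iff)
  have "Zfun (\<lambda>n. X n * (Y n - Y' n)) sequentially"
    by (rule bounded_bilinear.Bfun_prod_Zfun[OF bounded_bilinear_mult Cauchy_Bseq[OF C(1)] Z(2)])
  moreover have "Zfun (\<lambda>n. (X n - X' n) * Y' n) sequentially"
    by (rule bounded_bilinear.Zfun_prod_Bfun[OF bounded_bilinear_mult Z(1) Cauchy_Bseq[OF C(4)]])
  ultimately have "Zfun (\<lambda>n. X n * Y n - X' n * Y' n) sequentially"
    by (drule_tac Zfun_add) (auto simp: algebra_simps)
  with C show ?thesis by (simp add: cauchy_rel_def tendsto_Zfun_iff Cauchy_mult)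
qed

lemma cauchy_rel_lim_norm:
  assumes "cauchy_rel X Y"
  shows "lim (\<lambda>n. norm (X n)) = lim (\<lambda>n. norm (Y n))"
proof -
  from assms have C: "Cauchy X" "Cauchy Y" and Z: "(\<lambda>n. X n - Y n) \<longlonglongrightarrow> 0"
    by (auto simp: cauchy_rel_def)
  have "(\<lambda>n. norm (X n) - norm (Y n)) \<longlonglongrightarrow> 0"
    by (rule Lim_null_comparison[OF _ tendsto_norm_zero[OF Z]]) (simp add: norm_triangle_ineq3)
  moreover have "(\<lambda>n. norm (X n) - norm (Y n)) \<longlonglongrightarrow> lim (\<lambda>n. norm (X n)) - lim (\<lambda>n. norm (Y n))"
    using C by (intro tendsto_diff) (auto dest!: Cauchy_norm simp: convergent_LIMSEQ_iff)
  ultimately show ?thesis using LIMSEQ_unique by fastforce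
qed

lemma Cauchy_const_seq: "Cauchy (\<lambda>_. x)"
  by (simp add: convergent_Cauchy convergent_const)

instantiation completion :: (pre_cstar_algebra) pre_cstar_algebra
begin

lift_definition zero_completion :: "'a completion" is "\<lambda>_. 0"
  by (simp add: Cauchy_const_seq)

lift_definition one_completion :: "'a completion" is "\<lambda>_. 1"
  by (simp add: Cauchy_const_seq)

lift_definition plus_completion :: "'a completion \<Rightarrow> 'a completion \<Rightarrow> 'a completion"
  is "\<lambda>X Y n. X n + Y n" by (rule cauchy_rel_add)

lift_definition uminus_completion :: "'a completion \<Rightarrow> 'a completion"
  is "\<lambda>X n. - X n" by (rule cauchy_rel_bounded_linear[OF bounded_linear_minus[OF bounded_linear_ident]])

lift_definition times_completion :: "'a completion \<Rightarrow> 'a completion \<Rightarrow> 'a completion"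
  is "\<lambda>X Y n. X n * Y n" by (rule cauchy_rel_mult)

lift_definition scaleC_completion :: "complex \<Rightarrow> 'a completion \<Rightarrow> 'a completion"
  is "\<lambda>c X n. c *\<^sub>C X n" by (rule cauchy_rel_bounded_linear[OF bounded_linear_scaleC])

lift_definition star_completion :: "'a completion \<Rightarrow> 'a completion"
  is "\<lambda>X n. star (X n)" by (rule cauchy_rel_bounded_linear[OF bounded_linear_star])

lift_definition norm_completion :: "'a completion \<Rightarrow> real"
  is "\<lambda>X. lim (\<lambda>n. norm (X n))" by (rule cauchy_rel_lim_norm)

definition minus_completion :: "'a completion \<Rightarrow> 'a completion \<Rightarrow> 'a completion"
  where "x - y = x + - (y :: 'a completion)"

definition scaleR_completion :: "real \<Rightarrow> 'a completion \<Rightarrow> 'a completion"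
  where "r *\<^sub>R x = complex_of_real r *\<^sub>C (x :: 'a completion)"

definition sgn_completion :: "'a completion \<Rightarrow> 'a completion"
  where "sgn x = inverse (norm x) *\<^sub>R (x :: 'a completion)"

definition dist_completion :: "'a completion \<Rightarrow> 'a completion \<Rightarrow> real"
  where "dist x y = norm (x - y :: 'a completion)"

definition uniformity_completion :: "('a completion \<times> 'a completion) filter"
  where "uniformity_completion = (INF e\<in>{0<..}. principal {(x, y). dist x y < e})"

definition open_completion :: "'a completion set \<Rightarrow> bool"
  where "open_completion U \<longleftrightarrow> (\<forall>x\<in>U. \<forall>\<^sub>F (x', y) in uniformity. x' = x \<longrightarrow> y \<in> U)"

instance
proof
  have lim_norm: "(\<lambda>n. norm (X n)) \<longlonglongrightarrow> lim (\<lambda>n. norm (X n))" if "Cauchy X" for X :: "nat \<Rightarrow> 'a"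
    using Cauchy_norm[OF that] by (simp add: convergent_LIMSEQ_iff)
  fix x y z :: "'a completion" and a b :: complex and r s :: real and U :: "'a completion set"
  show "x + y + z = x + (y + z)"
    by transfer (simp add: add.assoc Cauchy_add)
  show "x + y = y + x"
    by transfer (simp add: add.commute Cauchy_add)
  show "0 + x = x"
    by transfer simp
  show "- x + x = 0"
    by transfer (simp add: Cauchy_const_seq)
  show "x - y = x + - y"
    by (fact minus_completion_def)
  show "x * y * z = x * (y * z)"
    by transfer (simp add: mult.assoc Cauchy_mult)
  show "(x + y) * z = x * z + y * z" "x * (y + z) = x * y + x * z"
    by (transfer, simp add: algebra_simps Cauchy_add Cauchy_mult)+
  show "1 * x = x" "x * 1 = x"
    by (transfer, simp)+
  show "(0 :: 'a completion) \<noteq> 1"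
    by transfer (auto simp: cauchy_rel_def tendsto_const_iff)
  have sC: "Cauchy (\<lambda>n. c *\<^sub>C X n)" if "Cauchy X" for c and X :: "nat \<Rightarrow> 'a"
    by (rule bounded_linear.Cauchy[OF bounded_linear_scaleC that])
  have sS: "Cauchy (\<lambda>n. star (X n))" if "Cauchy X" for X :: "nat \<Rightarrow> 'a"
    by (rule bounded_linear.Cauchy[OF bounded_linear_star that])
  show C1: "a *\<^sub>C (x + y) = a *\<^sub>C x + a *\<^sub>C y" for a and x y :: "'a completion"
    by transfer (simp add: scaleC_add_right sC Cauchy_add flip: scaleC_add_right)
  show C2: "(a + b) *\<^sub>C x = a *\<^sub>C x + b *\<^sub>C x" for a b and x :: "'a completion"
    by transfer (simp add: sC Cauchy_add flip: scaleC_add_left)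
  show C3: "a *\<^sub>C b *\<^sub>C x = (a * b) *\<^sub>C x" for a b and x :: "'a completion"
    by transfer (simp add: scaleC_scaleC sC)
  have C4: "1 *\<^sub>C x = x" for x :: "'a completion"
    by transfer simp
  show C5: "norm (a *\<^sub>C x) = cmod a * norm x" for a and x :: "'a completion"
    by transfer (auto simp: norm_scaleC intro!: limI tendsto_mult_left lim_norm)
  have M: "(a *\<^sub>C x) * y = a *\<^sub>C (x * y)" "x * (a *\<^sub>C y) = a *\<^sub>C (x * y)" for a and x y :: "'a completion"
    by (transfer, simp add: mult_scaleC_left mult_scaleC_right sC Cauchy_mult)+
  show "(a *\<^sub>C x) * y = a *\<^sub>C (x * y)" "x * (a *\<^sub>C y) = a *\<^sub>C (x * y)"
    by (fact M)+
  show "r *\<^sub>R x = complex_of_real r *\<^sub>C x"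
    by (fact scaleR_completion_def)
  show "r *\<^sub>R (x + y) = r *\<^sub>R x + r *\<^sub>R y" "(r + s) *\<^sub>R x = r *\<^sub>R x + s *\<^sub>R x"
    "r *\<^sub>R s *\<^sub>R x = (r * s) *\<^sub>R x" "1 *\<^sub>R x = x"
    "(r *\<^sub>R x) * y = r *\<^sub>R (x * y)" "x * (r *\<^sub>R y) = r *\<^sub>R (x * y)"
    by (simp_all add: scaleR_completion_def C1 C2 C3 C4 M)
  show "dist x y = norm (x - y)"
    by (fact dist_completion_def)
  show "sgn x = inverse (norm x) *\<^sub>R x"
    by (fact sgn_completion_def)
  show "uniformity = (INF e\<in>{0 <..}. principal {(x, y :: 'a completion). dist x y < e})"
    by (fact uniformity_completion_def)
  show "open U \<longleftrightarrow> (\<forall>x\<in>U. \<forall>\<^sub>F (x', y) in uniformity. x' = x \<longrightarrow> y \<in> U)"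
    by (fact open_completion_def)
  show "norm x = 0 \<longleftrightarrow> x = 0"
  proof transfer
    fix X :: "nat \<Rightarrow> 'a" assume "cauchy_rel X X"
    then have "Cauchy X" by simp
    from lim_norm[OF this] show "lim (\<lambda>n. norm (X n)) = 0 \<longleftrightarrow> cauchy_rel X (\<lambda>_. 0)"
      using \<open>Cauchy X\<close> by (auto simp: cauchy_rel_def Cauchy_const_seq tendsto_norm_zero_iff intro: limI dest: tendsto_norm_zero)
  qed
  show "norm (x + y) \<le> norm x + norm y"
  proof transfer
    fix X Y :: "nat \<Rightarrow> 'a" assume "cauchy_rel X X" "cauchy_rel Y Y"
    then have "Cauchy X" "Cauchy Y" by simp_all
    then show "lim (\<lambda>n. norm (X n + Y n)) \<le> lim (\<lambda>n. norm (X n)) + lim (\<lambda>n. norm (Y n))"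
      by (intro LIMSEQ_le[OF lim_norm tendsto_add[OF lim_norm lim_norm]])
         (auto simp: Cauchy_add norm_triangle_ineq)
  qed
  show "norm (r *\<^sub>R x) = \<bar>r\<bar> * norm x"
    by (simp add: scaleR_completion_def C5)
  show "norm (x * y) \<le> norm x * norm y"
  proof transfer
    fix X Y :: "nat \<Rightarrow> 'a" assume "cauchy_rel X X" "cauchy_rel Y Y"
    then have "Cauchy X" "Cauchy Y" by simp_all
    then show "lim (\<lambda>n. norm (X n * Y n)) \<le> lim (\<lambda>n. norm (X n)) * lim (\<lambda>n. norm (Y n))"
      by (intro LIMSEQ_le[OF lim_norm tendsto_mult[OF lim_norm lim_norm]])
         (auto simp: Cauchy_mult norm_mult_ineq)
  qed
  show "norm (1 :: 'a completion) = 1"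
    by transfer (simp add: lim_const)
  show "star (star x) = x"
    by transfer (simp add: star_star)
  show "star (x + y) = star x + star y"
    by transfer (simp add: star_add sS Cauchy_add)
  show "star (a *\<^sub>C x) = cnj a *\<^sub>C star x"
    by transfer (simp add: star_scaleC sS sC)
  show "star (x * y) = star y * star x"
    by transfer (simp add: star_mult sS Cauchy_mult)
  show "norm (star x * x) = (norm x)\<^sup>2"
    by transfer (auto simp: cstar_identity intro!: limI tendsto_power lim_norm)
qed

end

lift_definition to_completion :: "'a::pre_cstar_algebra \<Rightarrow> 'a completion" is "\<lambda>x _. x"
  by (simp add: Cauchy_const_seq)

lemma to_completion_hom:
  "to_completion (x + y) = to_completion x + to_completion y"
  "to_completion (c *\<^sub>C x) = c *\<^sub>C to_completion x"
  "to_completion (x * y) = to_completion x * to_completion y"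
  "to_completion 1 = 1"
  "to_completion (star x) = star (to_completion x)"
  by (transfer, simp add: Cauchy_const_seq)+

lemma to_completion_minus:  "to_completion (- x) = - to_completion x"
  by (transfer, simp add: Cauchy_const_seq)

lemma to_completion_diff: "to_completion (x - y) = to_completion x - to_completion y"
  using to_completion_hom(1)[of x "- y"] by (simp add: to_completion_minus)

lemma norm_to_completion: "norm (to_completion x) = norm x"
  by transfer (simp add: lim_const)

lemma to_completion_tendsto:
  fixes X :: "nat \<Rightarrow> 'a::pre_cstar_algebra"
  assumes X: "Cauchy X"
  shows "(\<lambda>n. to_completion (X n)) \<longlonglongrightarrow> abs_completion X"
proof (rule LIMSEQ_I)
  fix e :: real assume "0 < e"
  then obtain N where N: "\<And>m n. m \<ge> N \<Longrightarrow> n \<ge> N \<Longrightarrow> norm (X m - X n) < e / 2"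
    using CauchyD[OF X, of "e / 2"] by auto
  have "norm (to_completion (X n) - abs_completion X) < e" if "n \<ge> N" for n
  proof -
    have C: "Cauchy (\<lambda>m. X n + - X m)"
      using X Cauchy_add[OF Cauchy_const_seq[of "X n"] bounded_linear.Cauchy[OF bounded_linear_minus[OF bounded_linear_ident] X]]
      by simp
    have *: "- abs_completion X = abs_completion (\<lambda>m. - X m)"
      by (rule uminus_completion.abs_eq) (simp add: X)
    have "to_completion (X n) - abs_completion X = abs_completion (\<lambda>m. X n + - X m)"
      unfolding minus_completion_def * to_completion.abs_eq
      by (rule plus_completion.abs_eq)
         (use X in \<open>simp_all add: Cauchy_const_seq bounded_linear.Cauchy[OF bounded_linear_minus[OF bounded_linear_ident]]\<close>)
    then have "norm (to_completion (X n) - abs_completion X) = lim (\<lambda>m. norm (X n + - X m))"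
      by (simp only: norm_completion.abs_eq[unfolded cauchy_rel_refl, OF C])
    also have "\<dots> \<le> e / 2"
    proof (rule LIMSEQ_le_const2)
      show "(\<lambda>m. norm (X n + - X m)) \<longlonglongrightarrow> lim (\<lambda>m. norm (X n + - X m))"
        using Cauchy_norm[OF C] by (simp add: convergent_LIMSEQ_iff)
      show "\<exists>M. \<forall>m\<ge>M. norm (X n + - X m) \<le> e / 2"
        using N[OF that] by (auto intro!: exI[of _ N] less_imp_le)
    qed
    finally show ?thesis using \<open>0 < e\<close> by simp
  qed
  then show "\<exists>N. \<forall>n\<ge>N. norm (to_completion (X n) - abs_completion X) < e" by blast
qed

lemma to_completion_dense: 
  assumes "e > 0"
  shows "\<exists>a. norm (x - to_completion a) < e"
proof -
  obtain X where X: "Cauchy X" "x = abs_completion X"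
    by (induct x rule: completion.abs_induct) simp
  from LIMSEQ_D[OF to_completion_tendsto[OF X(1)] assms] show ?thesis
    unfolding X(2) by (metis norm_minus_commute order_refl)
qed

instance completion :: (pre_cstar_algebra) cstar_algebra
proof
  fix S :: "nat \<Rightarrow> 'a completion"
  assume S: "Cauchy S"
  have "\<exists>a. norm (S n - to_completion a) < inverse (Suc n)" for n
    by (rule to_completion_dense) simp
  then obtain X where X: "\<And>n. norm (S n - to_completion (X n)) < inverse (Suc n)"
    by metis
  have lim: "(\<lambda>n. S n - to_completion (X n)) \<longlonglongrightarrow> 0"
    by (rule Lim_null_comparison[OF _ LIMSEQ_inverse_real_of_nat]) (use X in \<open>simp add: less_imp_le\<close>)
  have "Cauchy (\<lambda>n. S n + - (S n - to_completion (X n)))"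
    by (rule Cauchy_add[OF S LIMSEQ_imp_Cauchy[OF tendsto_minus[OF lim]]])
  then have "Cauchy (\<lambda>n. to_completion (X n))" by simp
  then have "Cauchy X"
    unfolding Cauchy_iff by (simp add: norm_to_completion flip: to_completion_diff)
  then have "(\<lambda>n. (S n - to_completion (X n)) + to_completion (X n)) \<longlonglongrightarrow> 0 + abs_completion X"
    by (intro tendsto_add lim to_completion_tendsto)
  then show "convergent S" by (auto simp: convergent_def)
qed

section \<open>The algebraic tensor product of copies of a matrix algebra over the integers\<close>

text \<open>
  For a finite index type \<open>'n\<close> with \<open>p\<close> elements, the tensor product over a finite \<open>F\<close> of copies
  of the \<open>p \<times> p\<close> matrices is the algebra of matrices \<open>m\<close> indexed by maps \<open>F \<rightarrow> 'n\<close> (represented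
  in \<open>PiE F (\<lambda>_. UNIV)\<close>). Its element \<open>m\<close> is identified with \<open>m \<otimes> 1\<close>, written as a matrix indexed by
  configurations on all of the integers. This makes the connecting maps \<open>m \<mapsto> m \<otimes> 1\<close> between finite
  sets inclusions, so that the algebraic infinite tensor product is the union over all finite \<open>F\<close>.
\<close>

type_synonym 'n config = "int \<Rightarrow> 'n"
type_synonym 'n matrix = "'n config \<Rightarrow> 'n config \<Rightarrow> complex"

definition local_matrix :: "int set \<Rightarrow> 'n matrix \<Rightarrow> 'n matrix" where
  "local_matrix F m =
     (\<lambda>s t. if \<forall>k. k \<notin> F \<longrightarrow> s k = t k then m (restrict s F) (restrict t F) else 0)"

text \<open>
  The operator norm is computed on the finitely supported vectors. A matrix \<open>m \<otimes> 1\<close> is block diagonal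
  with copies of \<open>m\<close> as blocks, so this is the C*-norm of \<open>m\<close> in the finite tensor product.
\<close>

definition finsupp :: "('i \<Rightarrow> complex) \<Rightarrow> bool" where
  "finsupp x \<longleftrightarrow> finite {t. x t \<noteq> 0}"

definition l2norm :: "('i \<Rightarrow> complex) \<Rightarrow> real" where
  "l2norm x = L2_set (\<lambda>t. cmod (x t)) {t. x t \<noteq> 0}"

definition matvec :: "('i \<Rightarrow> 'i \<Rightarrow> complex) \<Rightarrow> ('i \<Rightarrow> complex) \<Rightarrow> 'i \<Rightarrow> complex" where
  "matvec a x = (\<lambda>s. \<Sum>t | x t \<noteq> 0. a s t * x t)"

definition op_norm :: "('i \<Rightarrow> 'i \<Rightarrow> complex) \<Rightarrow> real" where
  "op_norm a = (SUP x \<in> {x. finsupp x \<and> l2norm x \<le> 1}. l2norm (matvec a x))"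

text \<open>The sum is finite for local matrices, whose rows are finitely supported.\<close>

definition mat_mult :: "('i \<Rightarrow> 'i \<Rightarrow> complex) \<Rightarrow> ('i \<Rightarrow> 'i \<Rightarrow> complex) \<Rightarrow> 'i \<Rightarrow> 'i \<Rightarrow> complex" where
  "mat_mult a b = (\<lambda>s t. \<Sum>u | a s u \<noteq> 0. a s u * b u t)"

subsection \<open>Finitely supported vectors\<close>

lemma l2norm_eq: "finite T \<Longrightarrow> {t. x t \<noteq> 0} \<subseteq> T \<Longrightarrow> l2norm x = L2_set (\<lambda>t. cmod (x t)) T"
  unfolding l2norm_def L2_set_def
  by (intro arg_cong[of _ _ sqrt] sum.mono_neutral_left) auto

lemma matvec_eq: "finite T \<Longrightarrow> {t. x t \<noteq> 0} \<subseteq> T \<Longrightarrow> matvec a x s = (\<Sum>t\<in>T. a s t * x t)"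
  unfolding matvec_def by (intro sum.mono_neutral_left) auto

lemma l2norm_nonneg [simp]: "0 \<le> l2norm x"
  by (simp add: l2norm_def)

lemma l2norm_zero [simp]: "l2norm (\<lambda>_. 0) = 0"
  by (simp add: l2norm_def)

lemma l2norm_eq_0: "finsupp x \<Longrightarrow> l2norm x = 0 \<longleftrightarrow> x = (\<lambda>_. 0)"
  unfolding l2norm_def finsupp_def by (auto simp: L2_set_eq_0_iff)

lemma finsupp_add: "finsupp x \<Longrightarrow> finsupp y \<Longrightarrow> finsupp (\<lambda>t. x t + y t)"
  unfolding finsupp_def
  by (rule finite_subset[of _ "{t. x t \<noteq> 0} \<union> {t. y t \<noteq> 0}"]) auto

lemma finsupp_scale: "finsupp x \<Longrightarrow> finsupp (\<lambda>t. c * x t)"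
  unfolding finsupp_def by (rule finite_subset[of _ "{t. x t \<noteq> 0}"]) auto

lemma l2norm_triangle:
  assumes "finsupp x" "finsupp y"
  shows "l2norm (\<lambda>t. x t + y t) \<le> l2norm x + l2norm y"
proof -
  let ?T = "{t. x t \<noteq> 0} \<union> {t. y t \<noteq> 0}"
  have f: "finite ?T" using assms by (simp add: finsupp_def)
  have "l2norm (\<lambda>t. x t + y t) = L2_set (\<lambda>t. cmod (x t + y t)) ?T"
    by (rule l2norm_eq[OF f]) auto
  also have "\<dots> \<le> L2_set (\<lambda>t. cmod (x t) + cmod (y t)) ?T"
    by (rule L2_set_mono) (auto intro: norm_triangle_ineq)
  also have "\<dots> \<le> L2_set (\<lambda>t. cmod (x t)) ?T + L2_set (\<lambda>t. cmod (y t)) ?T"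
    by (rule L2_set_triangle_ineq)
  finally show ?thesis by (simp add: l2norm_eq[OF f])
qed

lemma l2norm_scale: "l2norm (\<lambda>t. c * x t) = cmod c * l2norm x"
proof (cases "c = 0")
  case False
  then have "{t. c * x t \<noteq> 0} = {t. x t \<noteq> 0}" by auto
  then show ?thesis
    unfolding l2norm_def by (simp add: norm_mult L2_set_right_distrib)
qed simp

lemma sum_cnj_mult_le:
  assumes "finite T" "{t. x t \<noteq> 0} \<subseteq> T" "{t. y t \<noteq> 0} \<subseteq> T"
  shows "cmod (\<Sum>t\<in>T. cnj (x t) * y t) \<le> l2norm x * l2norm y"
proof -
  have "cmod (\<Sum>t\<in>T. cnj (x t) * y t) \<le> (\<Sum>t\<in>T. \<bar>cmod (x t)\<bar> * \<bar>cmod (y t)\<bar>)"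
    by (rule order_trans[OF norm_sum]) (simp add: norm_mult)
  also have "\<dots> \<le> l2norm x * l2norm y"
    using L2_set_mult_ineq[of "\<lambda>t. cmod (x t)" "\<lambda>t. cmod (y t)" T] assms by (simp add: l2norm_eq)
  finally show ?thesis .
qed

lemma l2norm_square:
  assumes "finite T" "{t. x t \<noteq> 0} \<subseteq> T"
  shows "(\<Sum>t\<in>T. cnj (x t) * x t) = of_real ((l2norm x)\<^sup>2)"
proof -
  have "cnj (x t) * x t = of_real ((cmod (x t))\<^sup>2)" for t
    by (simp only: complex_norm_square mult.commute[of "cnj (x t)"])
  moreover have "(l2norm x)\<^sup>2 = (\<Sum>t\<in>T. (cmod (x t))\<^sup>2)"
    by (simp add: l2norm_eq[OF assms] L2_set_def sum_nonneg)
  ultimately show ?thesis by (simp only: of_real_sum)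
qed

subsection \<open>Local matrices\<close>

definition nbhd :: "int set \<Rightarrow> 'n config \<Rightarrow> 'n config set" where
  "nbhd F s = {u. \<forall>k. k \<notin> F \<longrightarrow> s k = u k}"

definition supported :: "int set \<Rightarrow> 'n matrix \<Rightarrow> bool" where
  "supported F a \<longleftrightarrow> finite F \<and> (\<forall>s t. t \<notin> nbhd F s \<longrightarrow> a s t = 0)
     \<and> (\<forall>s t s' t'. t \<in> nbhd F s \<longrightarrow> t' \<in> nbhd F s' \<longrightarrow> (\<forall>k\<in>F. s k = s' k \<and> t k = t' k) \<longrightarrow> a s t = a s' t')"

lemma supportedI:
  assumes "finite F" "\<And>s t. t \<notin> nbhd F s \<Longrightarrow> a s t = 0"
    and "\<And>s t s' t'. t \<in> nbhd F s \<Longrightarrow> t' \<in> nbhd F s' \<Longrightarrow> \<forall>k\<in>F. s k = s' k \<Longrightarrow> \<forall>k\<in>F. t k = t' k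
      \<Longrightarrow> a s t = a s' t'"
  shows "supported F a"
  using assms unfolding supported_def by blast

lemma supported_finite: "supported F a \<Longrightarrow> finite F"
  unfolding supported_def by blast

lemma supported_0: "supported F a \<Longrightarrow> t \<notin> nbhd F s \<Longrightarrow> a s t = 0"
  unfolding supported_def by blast

lemma supported_eq:
  assumes "supported F a" "t \<in> nbhd F s" "t' \<in> nbhd F s'" "\<forall>k\<in>F. s k = s' k" "\<forall>k\<in>F. t k = t' k"
  shows "a s t = a s' t'"
  using assms unfolding supported_def by blast

lemma supported_iff: "supported F a \<longleftrightarrow> finite F \<and> (\<exists>m. a = local_matrix F m)"
proof safe
  assume *: "supported F a"
  then show "finite F" by (rule supported_finite)
  have "a = local_matrix F a"
  proof (intro ext)
    fix s t
    show "a s t = local_matrix F a s t"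
    proof (cases "t \<in> nbhd F s")
      case True
      moreover have "restrict t F \<in> nbhd F (restrict s F)" by (simp add: nbhd_def)
      ultimately have "a s t = a (restrict s F) (restrict t F)"
        using supported_eq[OF *, of t s "restrict t F" "restrict s F"] by simp
      with True show ?thesis by (simp add: local_matrix_def nbhd_def)
    next
      case False
      then have "local_matrix F a s t = 0" by (auto simp: local_matrix_def nbhd_def)
      with supported_0[OF * False] show ?thesis by (simp only:)
    qed
  qed
  then show "\<exists>m. a = local_matrix F m" by (rule exI[of _ a])
next
  fix m :: "'a matrix"
  assume F: "finite F"
  show "supported F (local_matrix F m)"
  proof (rule supportedI[OF F])
    fix s t :: "'a config" assume "t \<notin> nbhd F s"
    then show "local_matrix F m s t = 0" by (auto simp: local_matrix_def nbhd_def)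
  next
    fix s t s' t' :: "'a config"
    assume st: "t \<in> nbhd F s" "t' \<in> nbhd F s'" "\<forall>k\<in>F. s k = s' k" "\<forall>k\<in>F. t k = t' k"
    then have "restrict s F = restrict s' F" "restrict t F = restrict t' F"
      by (auto intro!: restrict_ext)
    with st(1,2) show "local_matrix F m s t = local_matrix F m s' t'"
      by (simp add: local_matrix_def nbhd_def)
  qed
qed

lemma nbhd_self [simp]: "s \<in> nbhd F s" by (simp add: nbhd_def)

lemma nbhd_sym: "t \<in> nbhd F s \<longleftrightarrow> s \<in> nbhd F t" by (auto simp: nbhd_def)

lemma nbhd_cong: "t \<in> nbhd F s \<Longrightarrow> nbhd F t = nbhd F s" by (auto simp: nbhd_def)

lemma finite_nbhd:
  fixes s :: "('n::finite) config"
  assumes "finite F"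
  shows "finite (nbhd F s)" "card (nbhd F s) \<le> card (PiE F (\<lambda>_. UNIV :: 'n set))"
proof -
  have fin: "finite (PiE F (\<lambda>_. UNIV :: 'n set))" using assms by (intro finite_PiE) auto
  have *: "nbhd F s \<subseteq> (\<lambda>v k. if k \<in> F then v k else s k) ` PiE F (\<lambda>_. UNIV)"
  proof
    fix u assume "u \<in> nbhd F s"
    then have "u = (\<lambda>k. if k \<in> F then restrict u F k else s k)" by (auto simp: nbhd_def)
    moreover have "restrict u F \<in> PiE F (\<lambda>_. UNIV)" by simp
    ultimately show "u \<in> (\<lambda>v k. if k \<in> F then v k else s k) ` PiE F (\<lambda>_. UNIV)"
      by (rule image_eqI)
  qed
  from fin * show "finite (nbhd F s)" by (meson finite_imageI finite_subset)
  from fin * show "card (nbhd F s) \<le> card (PiE F (\<lambda>_. UNIV :: 'n set))"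
    by (meson card_image_le card_mono finite_imageI order_trans)
qed

lemma supported_mono:
  assumes a: "supported F (a :: 'n matrix)" and G: "F \<subseteq> G" "finite G"
  shows "supported G a"
proof (rule supportedI)
  fix s t :: "'n config" assume "t \<notin> nbhd G s"
  then have "t \<notin> nbhd F s" using G by (auto simp: nbhd_def)
  then show "a s t = 0" by (rule supported_0[OF a])
next
  fix s t s' t' :: "'n config"
  assume st: "t \<in> nbhd G s" "t' \<in> nbhd G s'" "\<forall>k\<in>G. s k = s' k" "\<forall>k\<in>G. t k = t' k"
  then have *: "t k = s k \<and> t' k = s' k" if "k \<notin> G" for k
    using that by (simp add: nbhd_def)
  have "s k = t k \<longleftrightarrow> s' k = t' k" for k
    using * st(3,4) by (cases "k \<in> G") auto
  then have "t \<in> nbhd F s \<longleftrightarrow> t' \<in> nbhd F s'" by (simp add: nbhd_def)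
  then show "a s t = a s' t'"
    using st G supported_0[OF a] supported_eq[OF a, of t s t' s'] by (cases "t \<in> nbhd F s") auto
qed (fact G)

lemma mat_mult_eq:
  assumes "supported F (a :: ('n::finite) matrix)"
  shows "mat_mult a b s t = (\<Sum>u\<in>nbhd F s. a s u * b u t)"
  unfolding mat_mult_def
proof (rule sum.mono_neutral_left)
  show "{u. a s u \<noteq> 0} \<subseteq> nbhd F s" using supported_0[OF assms] by blast
  show "finite (nbhd F s)" by (rule finite_nbhd(1)[OF supported_finite[OF assms]])
qed simp

lemma matvec_nbhd:
  assumes "supported F (a :: ('n::finite) matrix)" "finsupp x"
  shows "matvec a x s = (\<Sum>t\<in>nbhd F s. a s t * x t)"
proof -
  have f: "finite (nbhd F s)" using assms(1) by (simp add: supported_finite finite_nbhd)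
  have "matvec a x s = (\<Sum>t\<in>{t. x t \<noteq> 0} \<union> nbhd F s. a s t * x t)"
    by (rule matvec_eq) (use assms(2) f in \<open>auto simp: finsupp_def\<close>)
  also have "\<dots> = (\<Sum>t\<in>nbhd F s. a s t * x t)"
    by (rule sum.mono_neutral_right)
       (use assms f in \<open>auto simp: finsupp_def supported_0\<close>)
  finally show ?thesis .
qed

lemma finsupp_matvec:
  assumes "supported F (a :: ('n::finite) matrix)" "finsupp x"
  shows "finsupp (matvec a x)"
  unfolding finsupp_def
proof (rule finite_subset)
  show "{s. matvec a x s \<noteq> 0} \<subseteq> (\<Union>t\<in>{t. x t \<noteq> 0}. nbhd F t)"
  proof
    fix s assume "s \<in> {s. matvec a x s \<noteq> 0}"
    then obtain t where "t \<in> nbhd F s" "a s t * x t \<noteq> 0"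
      unfolding matvec_nbhd[OF assms] by (auto elim: sum.not_neutral_contains_not_neutral)
    then show "s \<in> (\<Union>t\<in>{t. x t \<noteq> 0}. nbhd F t)" by (auto simp: nbhd_sym)
  qed
  show "finite (\<Union>t\<in>{t. x t \<noteq> 0}. nbhd F t)"
    using assms by (auto simp: finsupp_def supported_finite finite_nbhd)
qed

lemma supported_add:
  assumes "supported F a" "supported F b"
  shows "supported F (\<lambda>s t. a s t + b s t)"
proof (rule supportedI)
  show "a s t + b s t = a s' t' + b s' t'"
    if "t \<in> nbhd F s" "t' \<in> nbhd F s'" "\<forall>k\<in>F. s k = s' k" "\<forall>k\<in>F. t k = t' k" for s t s' t'
    by (simp only: supported_eq[OF assms(1) that] supported_eq[OF assms(2) that])
qed (simp_all add: supported_finite[OF assms(1)] supported_0[OF assms(1)] supported_0[OF assms(2)])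

lemma supported_scale:
  assumes "supported F a"
  shows "supported F (\<lambda>s t. c * a s t)"
proof (rule supportedI)
  show "c * a s t = c * a s' t'"
    if "t \<in> nbhd F s" "t' \<in> nbhd F s'" "\<forall>k\<in>F. s k = s' k" "\<forall>k\<in>F. t k = t' k" for s t s' t'
    by (simp only: supported_eq[OF assms that])
qed (simp_all add: supported_finite[OF assms] supported_0[OF assms])

lemma supported_adj:
  assumes "supported F a"
  shows "supported F (\<lambda>s t. cnj (a t s))"
proof (rule supportedI)
  show "cnj (a t s) = cnj (a t' s')"
    if "t \<in> nbhd F s" "t' \<in> nbhd F s'" "\<forall>k\<in>F. s k = s' k" "\<forall>k\<in>F. t k = t' k" for s t s' t'
    using supported_eq[OF assms that(1,2)[THEN iffD1[OF nbhd_sym]] that(4,3)] by (simp only:)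
  show "cnj (a t s) = 0" if "t \<notin> nbhd F s" for s t
    using that supported_0[OF assms, of s t] by (simp add: nbhd_sym[of s])
qed (rule supported_finite[OF assms])

lemma supported_one: "supported {} (\<lambda>s t. if s = t then 1 else 0)"
  by (auto simp: supported_def nbhd_def)

lemma supported_zero: "supported {} (\<lambda>s t. 0)"
  by (auto simp: supported_def nbhd_def)

lemma supported_mult:
  assumes a: "supported F (a :: ('n::finite) matrix)" and b: "supported F b"
  shows "supported F (mat_mult a b)"
proof (rule supportedI)
  show "finite F" by (rule supported_finite[OF a])
next
  fix s t :: "'n config" assume "t \<notin> nbhd F s"
  then have "a s u * b u t = 0" if "u \<in> nbhd F s" for u
    using nbhd_cong[OF that] b by (simp add: supported_0)
  then show "mat_mult a b s t = 0" unfolding mat_mult_eq[OF a] by (intro sum.neutral) auto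
next
  fix s t s' t' :: "'n config"
  assume st: "t \<in> nbhd F s" "t' \<in> nbhd F s'" "\<forall>k\<in>F. s k = s' k" "\<forall>k\<in>F. t k = t' k"
  let ?f = "\<lambda>s u k. if k \<in> F then u k else s k"
  show "mat_mult a b s t = mat_mult a b s' t'"
    unfolding mat_mult_eq[OF a]
  proof (rule sum.reindex_bij_witness[where i = "?f s" and j = "?f s'"])
    fix u assume u: "u \<in> nbhd F s"
    show "?f s (?f s' u) = u" using u by (auto simp: nbhd_def)
    show v: "?f s' u \<in> nbhd F s'" by (auto simp: nbhd_def)
    have "a s u = a s' (?f s' u)"
      using u v st by (intro supported_eq[OF a]) auto
    moreover have "t \<in> nbhd F u" "t' \<in> nbhd F (?f s' u)"
      using u v st nbhd_cong by blast+
    then have "b u t = b (?f s' u) t'"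
      using st by (intro supported_eq[OF b]) auto
    ultimately show "a s' (?f s' u) * b (?f s' u) t' = a s u * b u t" by simp
  qed (auto simp: nbhd_def)
qed

lemma mat_mult_assoc:
  assumes a: "supported F (a :: ('n::finite) matrix)" and b: "supported F b"
  shows "mat_mult (mat_mult a b) c = mat_mult a (mat_mult b c)"
proof (intro ext)
  fix s t
  have "mat_mult (mat_mult a b) c s t = (\<Sum>v\<in>nbhd F s. \<Sum>u\<in>nbhd F s. a s u * b u v * c v t)"
    by (simp add: mat_mult_eq[OF supported_mult[OF a b]] mat_mult_eq[OF a] sum_distrib_right)
  also have "\<dots> = (\<Sum>u\<in>nbhd F s. \<Sum>v\<in>nbhd F s. a s u * b u v * c v t)"
    by (rule sum.swap)
  also have "\<dots> = (\<Sum>u\<in>nbhd F s. a s u * (\<Sum>v\<in>nbhd F u. b u v * c v t))"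
    by (intro sum.cong) (simp_all add: nbhd_cong sum_distrib_left mult.assoc)
  also have "\<dots> = mat_mult a (mat_mult b c) s t"
    by (simp add: mat_mult_eq[OF a] mat_mult_eq[OF b])
  finally show "mat_mult (mat_mult a b) c s t = mat_mult a (mat_mult b c) s t" .
qed

lemma matvec_mult:
  assumes a: "supported F (a :: ('n::finite) matrix)" and b: "supported F b" and x: "finsupp x"
  shows "matvec (mat_mult a b) x = matvec a (matvec b x)"
proof
  fix s
  have "matvec (mat_mult a b) x s = (\<Sum>t\<in>nbhd F s. \<Sum>u\<in>nbhd F s. a s u * b u t * x t)"
    by (simp add: matvec_nbhd[OF supported_mult[OF a b] x] mat_mult_eq[OF a] sum_distrib_right)
  also have "\<dots> = (\<Sum>u\<in>nbhd F s. \<Sum>t\<in>nbhd F s. a s u * b u t * x t)"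
    by (rule sum.swap)
  also have "\<dots> = (\<Sum>u\<in>nbhd F s. a s u * (\<Sum>t\<in>nbhd F u. b u t * x t))"
    by (intro sum.cong) (simp_all add: nbhd_cong sum_distrib_left mult.assoc)
  also have "\<dots> = matvec a (matvec b x) s"
    by (simp add: matvec_nbhd[OF a finsupp_matvec[OF b x]] matvec_nbhd[OF b x])
  finally show "matvec (mat_mult a b) x s = matvec a (matvec b x) s" .
qed

lemma matvec_adjoint:
  assumes a: "supported F (a :: ('n::finite) matrix)" and x: "finsupp x" and y: "finsupp y"
    and T: "finite T" "{t. x t \<noteq> 0} \<subseteq> T" "{t. y t \<noteq> 0} \<subseteq> T"
  shows "(\<Sum>s\<in>T. cnj (y s) * matvec a x s) = (\<Sum>t\<in>T. cnj (matvec (\<lambda>s t. cnj (a t s)) y t) * x t)"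
proof -
  have "(\<Sum>s\<in>T. cnj (y s) * matvec a x s) = (\<Sum>s\<in>T. \<Sum>t\<in>T. cnj (y s) * a s t * x t)"
    using T by (simp add: matvec_eq[of T] sum_distrib_left mult.assoc)
  also have "\<dots> = (\<Sum>t\<in>T. \<Sum>s\<in>T. cnj (y s) * a s t * x t)"
    by (rule sum.swap)
  also have "\<dots> = (\<Sum>t\<in>T. cnj (matvec (\<lambda>s t. cnj (a t s)) y t) * x t)"
    using T by (simp add: matvec_eq[of T] sum_distrib_right sum_distrib_left mult_ac)
  finally show ?thesis .
qed

lemma supported_bounded:
  assumes a: "supported F (a :: ('n::finite) matrix)"
  shows "\<exists>K\<ge>0. \<forall>x. finsupp x \<longrightarrow> l2norm (matvec a x) \<le> K * l2norm x"
proof -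
  let ?P = "PiE F (\<lambda>_. UNIV :: 'n set)"
  have F: "finite F" using a by (rule supported_finite)
  then have P: "finite ?P" by (intro finite_PiE) auto
  obtain m where m: "a = local_matrix F m" using a supported_iff by blast
  define B where "B = (\<Sum>v\<in>?P. \<Sum>w\<in>?P. cmod (m v w))"
  define N where "N = real (card ?P)"
  have B: "cmod (a s t) \<le> B" for s t
  proof -
    have "cmod (m (restrict s F) (restrict t F)) \<le> (\<Sum>w\<in>?P. cmod (m (restrict s F) w))"
      using P by (intro member_le_sum) auto
    also have "\<dots> \<le> B"
      unfolding B_def using P by (intro member_le_sum[where f = "\<lambda>v. \<Sum>w\<in>?P. cmod (m v w)"]) (auto intro: sum_nonneg)
    finally show ?thesis
      unfolding m local_matrix_def by (auto simp: B_def intro!: sum_nonneg)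
  qed
  have B0: "0 \<le> B" by (auto simp: B_def intro!: sum_nonneg)
  have cN: "real (card (nbhd F s)) \<le> N" for s :: "'n config"
    unfolding N_def using finite_nbhd(2)[OF F] by (simp only: of_nat_le_iff)
  show ?thesis
  proof (intro exI[of _ "N * B"] conjI allI impI)
    show "0 \<le> N * B" using B0 by (simp add: N_def)
    fix x :: "'n config \<Rightarrow> complex" assume x: "finsupp x"
    let ?X = "{t. x t \<noteq> 0}" let ?S = "{s. matvec a x s \<noteq> 0}"
    have fX: "finite ?X" and fS: "finite ?S"
      using x finsupp_matvec[OF a x] by (auto simp: finsupp_def)
    have fn: "finite (nbhd F s)" for s :: "'n config" by (rule finite_nbhd(1)[OF F])
    have row: "(cmod (matvec a x s))\<^sup>2 \<le> N * B\<^sup>2 * (\<Sum>t | t \<in> ?X \<and> t \<in> nbhd F s. (cmod (x t))\<^sup>2)" for s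
    proof -
      have "cmod (matvec a x s) \<le> (\<Sum>t\<in>nbhd F s. \<bar>cmod (a s t)\<bar> * \<bar>cmod (x t)\<bar>)"
        unfolding matvec_nbhd[OF a x] by (rule order_trans[OF norm_sum]) (simp add: norm_mult)
      also have "\<dots> \<le> L2_set (\<lambda>t. cmod (a s t)) (nbhd F s) * L2_set (\<lambda>t. cmod (x t)) (nbhd F s)"
        by (rule L2_set_mult_ineq)
      finally have "(cmod (matvec a x s))\<^sup>2
          \<le> (L2_set (\<lambda>t. cmod (a s t)) (nbhd F s) * L2_set (\<lambda>t. cmod (x t)) (nbhd F s))\<^sup>2"
        by (intro power_mono) auto
      also have "\<dots> = (\<Sum>t\<in>nbhd F s. (cmod (a s t))\<^sup>2) * (\<Sum>t\<in>nbhd F s. (cmod (x t))\<^sup>2)"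
        by (simp add: power_mult_distrib L2_set_def sum_nonneg)
      also have "\<dots> \<le> (N * B\<^sup>2) * (\<Sum>t\<in>nbhd F s. (cmod (x t))\<^sup>2)"
      proof (intro mult_right_mono sum_nonneg)
        have "(\<Sum>t\<in>nbhd F s. (cmod (a s t))\<^sup>2) \<le> (\<Sum>t\<in>nbhd F s. B\<^sup>2)"
          by (intro sum_mono power_mono B) auto
        also have "\<dots> = real (card (nbhd F s)) * B\<^sup>2" by simp
        also have "\<dots> \<le> N * B\<^sup>2" by (intro mult_right_mono cN) auto
        finally show "(\<Sum>t\<in>nbhd F s. (cmod (a s t))\<^sup>2) \<le> N * B\<^sup>2" .
      qed auto
      also have "(\<Sum>t\<in>nbhd F s. (cmod (x t))\<^sup>2) = (\<Sum>t | t \<in> ?X \<and> t \<in> nbhd F s. (cmod (x t))\<^sup>2)"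
        by (rule sum.mono_neutral_right) (auto simp: fn)
      finally show ?thesis .
    qed
    have "(l2norm (matvec a x))\<^sup>2 = (\<Sum>s\<in>?S. (cmod (matvec a x s))\<^sup>2)"
      by (simp add: l2norm_def L2_set_def sum_nonneg)
    also have "\<dots> \<le> (\<Sum>s\<in>?S. N * B\<^sup>2 * (\<Sum>t | t \<in> ?X \<and> t \<in> nbhd F s. (cmod (x t))\<^sup>2))"
      by (intro sum_mono row)
    also have "\<dots> = N * B\<^sup>2 * (\<Sum>s\<in>?S. \<Sum>t | t \<in> ?X \<and> t \<in> nbhd F s. (cmod (x t))\<^sup>2)"
      by (simp add: sum_distrib_left)
    also have "(\<Sum>s\<in>?S. \<Sum>t | t \<in> ?X \<and> t \<in> nbhd F s. (cmod (x t))\<^sup>2)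
        = (\<Sum>t\<in>?X. \<Sum>s | s \<in> ?S \<and> t \<in> nbhd F s. (cmod (x t))\<^sup>2)"
      by (rule sum.swap_restrict[OF fS fX])
    also have "N * B\<^sup>2 * \<dots> \<le> N * B\<^sup>2 * (\<Sum>t\<in>?X. N * (cmod (x t))\<^sup>2)"
    proof (intro mult_left_mono sum_mono)
      fix t
      have "card {s. s \<in> ?S \<and> t \<in> nbhd F s} \<le> card (nbhd F t)"
        by (intro card_mono fn) (auto simp: nbhd_sym)
      then have "real (card {s. s \<in> ?S \<and> t \<in> nbhd F s}) \<le> N" using cN[of t] by linarith
      then show "(\<Sum>s | s \<in> ?S \<and> t \<in> nbhd F s. (cmod (x t))\<^sup>2) \<le> N * (cmod (x t))\<^sup>2"
        by (simp add: mult_right_mono)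
    qed (simp add: N_def)
    also have "\<dots> = (N * B * l2norm x)\<^sup>2"
      by (simp add: l2norm_def L2_set_def sum_nonneg power_mult_distrib power2_eq_square
          flip: sum_distrib_left)
    finally show "l2norm (matvec a x) \<le> N * B * l2norm x"
      by (rule power2_le_imp_le) (use B0 in \<open>simp add: N_def\<close>)
  qed
qed

subsection \<open>The operator norm\<close>

lemma op_norm_bdd:
  assumes a: "supported F (a :: ('n::finite) matrix)"
  shows "bdd_above ((\<lambda>x. l2norm (matvec a x)) ` {x. finsupp x \<and> l2norm x \<le> 1})"
proof -
  obtain K where K: "K \<ge> 0" "\<And>x. finsupp x \<Longrightarrow> l2norm (matvec a x) \<le> K * l2norm x"
    using supported_bounded[OF a] by blast
  have "l2norm (matvec a x) \<le> K" if "finsupp x" "l2norm x \<le> 1" for x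
    using K(2)[OF that(1)] mult_left_le[OF that(2) K(1)] by linarith
  then show ?thesis by (auto intro!: bdd_aboveI[of _ K])
qed

lemma nbhd_empty: "nbhd {} s = {s}"
  by (auto simp: nbhd_def)

lemma finsupp_zero [simp]: "finsupp (\<lambda>_. 0)" by (simp add: finsupp_def)

lemma op_norm_nonneg:
  assumes a: "supported F (a :: ('n::finite) matrix)"
  shows "0 \<le> op_norm a"
  unfolding op_norm_def
  by (rule cSUP_upper2[OF op_norm_bdd[OF a], of "\<lambda>_. 0"]) simp_all

lemma matvec_scale:
  assumes "finsupp x"
  shows "matvec a (\<lambda>t. c * x t) = (\<lambda>s. c * matvec a x s)"
proof
  fix s
  have "matvec a (\<lambda>t. c * x t) s = (\<Sum>t | x t \<noteq> 0. a s t * (c * x t))"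
    by (rule matvec_eq) (use assms in \<open>auto simp: finsupp_def\<close>)
  also have "\<dots> = c * matvec a x s" by (simp add: matvec_def sum_distrib_left mult_ac)
  finally show "matvec a (\<lambda>t. c * x t) s = c * matvec a x s" .
qed

lemma op_norm_bound:
  assumes a: "supported F (a :: ('n::finite) matrix)" and x: "finsupp x"
  shows "l2norm (matvec a x) \<le> op_norm a * l2norm x"
proof (cases "l2norm x = 0")
  case True
  then have "x = (\<lambda>_. 0)" using x l2norm_eq_0 by blast
  then show ?thesis by (simp add: matvec_def)
next
  case False
  define c where "c = complex_of_real (inverse (l2norm x))"
  have c: "cmod c = inverse (l2norm x)" by (simp add: c_def norm_inverse)
  have "l2norm (matvec a (\<lambda>t. c * x t)) \<le> op_norm a"
    unfolding op_norm_def
    by (rule cSUP_upper[OF _ op_norm_bdd[OF a]])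
       (use False in \<open>simp add: finsupp_scale[OF x] l2norm_scale c\<close>)
  then have "inverse (l2norm x) * l2norm (matvec a x) \<le> op_norm a"
    by (simp only: matvec_scale[OF x] l2norm_scale c)
  then have "l2norm x * (inverse (l2norm x) * l2norm (matvec a x)) \<le> l2norm x * op_norm a"
    by (rule mult_left_mono) simp
  then show ?thesis using False by (simp add: mult.commute flip: mult.assoc)
qed

lemma op_norm_le:
  fixes a :: "'i \<Rightarrow> 'i \<Rightarrow> complex"
  assumes "K \<ge> 0" "\<And>x. finsupp x \<Longrightarrow> l2norm (matvec a x) \<le> K * l2norm x"
  shows "op_norm a \<le> K"
  unfolding op_norm_def
proof (rule cSUP_least)
  show "{x. finsupp x \<and> l2norm x \<le> 1} \<noteq> {}" by (auto intro: exI[of _ "\<lambda>_. 0"])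
  fix x :: "'i \<Rightarrow> complex" assume x: "x \<in> {x. finsupp x \<and> l2norm x \<le> 1}"
  then have "l2norm (matvec a x) \<le> K * l2norm x" using assms(2) by simp
  also have "\<dots> \<le> K" using x assms(1) by (simp add: mult_left_le)
  finally show "l2norm (matvec a x) \<le> K" .
qed

lemma op_norm_triangle:
  assumes a: "supported F (a :: ('n::finite) matrix)" and b: "supported F b"
  shows "op_norm (\<lambda>s t. a s t + b s t) \<le> op_norm a + op_norm b"
proof (rule op_norm_le)
  show "0 \<le> op_norm a + op_norm b" using op_norm_nonneg[OF a] op_norm_nonneg[OF b] by simp
  fix x :: "'n config \<Rightarrow> complex" assume x: "finsupp x"
  have "matvec (\<lambda>s t. a s t + b s t) x = (\<lambda>s. matvec a x s + matvec b x s)"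
    by (simp add: matvec_def distrib_right sum.distrib)
  then have "l2norm (matvec (\<lambda>s t. a s t + b s t) x) \<le> l2norm (matvec a x) + l2norm (matvec b x)"
    using l2norm_triangle[OF finsupp_matvec[OF a x] finsupp_matvec[OF b x]] by simp
  also have "\<dots> \<le> (op_norm a + op_norm b) * l2norm x"
    using op_norm_bound[OF a x] op_norm_bound[OF b x] by (simp add: distrib_right)
  finally show "l2norm (matvec (\<lambda>s t. a s t + b s t) x) \<le> (op_norm a + op_norm b) * l2norm x" .
qed

lemma op_norm_scale_le:
  assumes a: "supported F (a :: ('n::finite) matrix)"
  shows "op_norm (\<lambda>s t. c * a s t) \<le> cmod c * op_norm a"
proof (rule op_norm_le)
  show "0 \<le> cmod c * op_norm a" using op_norm_nonneg[OF a] by simp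
  fix x :: "'n config \<Rightarrow> complex" assume x: "finsupp x"
  have "matvec (\<lambda>s t. c * a s t) x = (\<lambda>s. c * matvec a x s)"
    by (simp add: matvec_def sum_distrib_left mult.assoc)
  then show "l2norm (matvec (\<lambda>s t. c * a s t) x) \<le> cmod c * op_norm a * l2norm x"
    using mult_left_mono[OF op_norm_bound[OF a x], of "cmod c"] by (simp add: l2norm_scale mult.assoc)
qed

lemma op_norm_scale:
  assumes a: "supported F (a :: ('n::finite) matrix)"
  shows "op_norm (\<lambda>s t. c * a s t) = cmod c * op_norm a"
proof (cases "c = 0")
  case True
  have "op_norm (\<lambda>(s::'n config) t. 0) \<le> 0"
    by (rule op_norm_le) (simp_all add: matvec_def)
  with True antisym[OF _ op_norm_nonneg[OF supported_zero]] show ?thesis by simp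
next
  case False
  have "op_norm a \<le> cmod (inverse c) * op_norm (\<lambda>s t. c * a s t)"
    using op_norm_scale_le[OF supported_scale[OF a], of "inverse c" c] False
    by (simp flip: mult.assoc)
  then have "cmod c * op_norm a \<le> cmod c * (cmod (inverse c) * op_norm (\<lambda>s t. c * a s t))"
    by (rule mult_left_mono) simp
  then have "cmod c * op_norm a \<le> op_norm (\<lambda>s t. c * a s t)"
    using False by (simp add: norm_inverse flip: mult.assoc)
  with op_norm_scale_le[OF a, of c] show ?thesis by simp
qed

lemma op_norm_mult:
  assumes a: "supported F (a :: ('n::finite) matrix)" and b: "supported F b"
  shows "op_norm (mat_mult a b) \<le> op_norm a * op_norm b"
proof (rule op_norm_le)
  show "0 \<le> op_norm a * op_norm b" using op_norm_nonneg[OF a] op_norm_nonneg[OF b] by simp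
  fix x :: "'n config \<Rightarrow> complex" assume x: "finsupp x"
  have "l2norm (matvec (mat_mult a b) x) \<le> op_norm a * l2norm (matvec b x)"
    unfolding matvec_mult[OF a b x] by (rule op_norm_bound[OF a finsupp_matvec[OF b x]])
  also have "\<dots> \<le> op_norm a * (op_norm b * l2norm x)"
    by (intro mult_left_mono op_norm_bound[OF b x] op_norm_nonneg[OF a])
  finally show "l2norm (matvec (mat_mult a b) x) \<le> op_norm a * op_norm b * l2norm x"
    by (simp add: mult.assoc)
qed

lemma op_norm_one: "op_norm (\<lambda>(s :: ('n::finite) config) t. if s = t then 1 else 0) = 1"
proof (rule antisym)
  let ?e = "\<lambda>t :: 'n config. if t = (\<lambda>_. undefined) then 1 else (0::complex)"
  have id: "matvec (\<lambda>s t. if s = t then 1 else 0) x = x" if "finsupp x" for x :: "'n config \<Rightarrow> complex"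
  proof
    fix s
    have "matvec (\<lambda>s t. if s = t then 1 else 0) x s = (\<Sum>t\<in>{s}. (if s = t then 1 else 0) * x t)"
      by (simp only: matvec_nbhd[OF supported_one that] nbhd_empty)
    then show "matvec (\<lambda>s t. if s = t then 1 else 0) x s = x s" by simp
  qed
  show "op_norm (\<lambda>(s :: 'n config) t. if s = t then 1 else 0) \<le> 1"
    by (rule op_norm_le) (simp_all add: id)
  have e: "finsupp ?e" "l2norm ?e = 1" by (simp_all add: finsupp_def l2norm_def)
  from op_norm_bound[OF supported_one e(1)]
  show "1 \<le> op_norm (\<lambda>(s :: 'n config) t. if s = t then 1 else 0)"
    by (simp only: id[OF e(1)] e(2) mult_1_right)
qed

lemma op_norm_eq_0:
  assumes a: "supported F (a :: ('n::finite) matrix)" and "op_norm a = 0"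
  shows "a = (\<lambda>s t. 0)"
proof (intro ext)
  fix s t
  let ?e = "\<lambda>u :: 'n config. if u = t then 1 else (0::complex)"
  have e: "finsupp ?e" by (simp add: finsupp_def)
  from op_norm_bound[OF a e] assms(2) have "l2norm (matvec a ?e) = 0"
    using l2norm_nonneg[of "matvec a ?e"] by (metis mult_zero_left order_antisym)
  then have "matvec a ?e = (\<lambda>_. 0)" using l2norm_eq_0[OF finsupp_matvec[OF a e]] by blast
  then have "matvec a ?e s = 0" by simp
  moreover have "matvec a ?e s = a s t" by (simp add: matvec_def)
  ultimately show "a s t = 0" by simp
qed

lemma op_norm_cstar:
  assumes a: "supported F (a :: ('n::finite) matrix)"
  shows "op_norm (mat_mult (\<lambda>s t. cnj (a t s)) a) = (op_norm a)\<^sup>2"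
proof -
  have *: "(op_norm b)\<^sup>2 \<le> op_norm (mat_mult (\<lambda>s t. cnj (b t s)) b)"
    if b: "supported F b" for b :: "'n matrix"
  proof -
    let ?b' = "\<lambda>s t. cnj (b t s)"
    let ?M = "op_norm (mat_mult ?b' b)"
    have s: "supported F (mat_mult ?b' b)" by (intro supported_mult supported_adj b)
    have M: "0 \<le> ?M" by (rule op_norm_nonneg[OF s])
    have "op_norm b \<le> sqrt ?M"
    proof (rule op_norm_le)
      show "0 \<le> sqrt ?M" using M by simp
      fix x :: "'n config \<Rightarrow> complex" assume x: "finsupp x"
      let ?y = "matvec b x" let ?z = "matvec ?b' ?y"
      let ?T = "{t. x t \<noteq> 0} \<union> {t. ?y t \<noteq> 0} \<union> {t. ?z t \<noteq> 0}"
      have y: "finsupp ?y" by (rule finsupp_matvec[OF b x])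
      have z: "finsupp ?z" by (rule finsupp_matvec[OF supported_adj[OF b] y])
      have T: "finite ?T" using x y z by (simp add: finsupp_def)
      have "of_real ((l2norm ?y)\<^sup>2) = (\<Sum>t\<in>?T. cnj (?y t) * ?y t)"
        by (rule l2norm_square[OF T, symmetric]) auto
      also have "\<dots> = (\<Sum>t\<in>?T. cnj (?z t) * x t)"
        by (rule matvec_adjoint[OF b x y T]) auto
      finally have "cmod (of_real ((l2norm ?y)\<^sup>2)) = cmod (\<Sum>t\<in>?T. cnj (?z t) * x t)"
        by (rule arg_cong)
      also have "\<dots> \<le> l2norm ?z * l2norm x"
        by (rule sum_cnj_mult_le[OF T]) auto
      also have "l2norm ?z \<le> ?M * l2norm x"
        using op_norm_bound[OF s x] by (simp only: matvec_mult[OF supported_adj[OF b] b x])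
      then have "l2norm ?z * l2norm x \<le> ?M * l2norm x * l2norm x"
        by (rule mult_right_mono) simp
      finally have "(l2norm ?y)\<^sup>2 \<le> ?M * (l2norm x)\<^sup>2"
        by (simp add: power2_eq_square norm_mult mult.assoc)
      then have "sqrt ((l2norm ?y)\<^sup>2) \<le> sqrt (?M * (l2norm x)\<^sup>2)"
        by (rule real_sqrt_le_mono)
      then show "l2norm ?y \<le> sqrt ?M * l2norm x" by (simp add: real_sqrt_mult)
    qed
    then have "(op_norm b)\<^sup>2 \<le> (sqrt ?M)\<^sup>2"
      by (rule power_mono) (rule op_norm_nonneg[OF b])
    then show ?thesis using M by simp
  qed
  have le: "op_norm b \<le> op_norm (\<lambda>s t. cnj (b t s))" if b: "supported F b" for b :: "'n matrix"
  proof (cases "op_norm b = 0")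
    case True
    then show ?thesis using op_norm_nonneg[OF supported_adj[OF b]] by simp
  next
    case False
    then have "op_norm b > 0" using op_norm_nonneg[OF b] by simp
    moreover have "op_norm b * op_norm b \<le> op_norm (\<lambda>s t. cnj (b t s)) * op_norm b"
      using *[OF b] op_norm_mult[OF supported_adj[OF b] b] by (simp add: power2_eq_square)
    ultimately show ?thesis by simp
  qed
  have "op_norm (\<lambda>s t. cnj (a t s)) \<le> op_norm a"
    using le[OF supported_adj[OF a]] by simp
  then have "op_norm (mat_mult (\<lambda>s t. cnj (a t s)) a) \<le> (op_norm a)\<^sup>2"
    using op_norm_mult[OF supported_adj[OF a] a] mult_right_mono[OF _ op_norm_nonneg[OF a]]
    unfolding power2_eq_square by fastforce
  with *[OF a] show ?thesis by simp
qed

subsection \<open>The local algebra\<close>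

lemma mat_mult_add_left:
  assumes a: "supported F (a :: ('n::finite) matrix)" and b: "supported F b"
  shows "mat_mult (\<lambda>s t. a s t + b s t) c = (\<lambda>s t. mat_mult a c s t + mat_mult b c s t)"
  by (simp only: fun_eq_iff mat_mult_eq[OF a] mat_mult_eq[OF b] mat_mult_eq[OF supported_add[OF a b]]
      distrib_right sum.distrib) simp

lemma mat_mult_scale_left:
  assumes a: "supported F (a :: ('n::finite) matrix)"
  shows "mat_mult (\<lambda>s t. k * a s t) c = (\<lambda>s t. k * mat_mult a c s t)"
  by (simp only: fun_eq_iff mat_mult_eq[OF a] mat_mult_eq[OF supported_scale[OF a]]
      sum_distrib_left mult.assoc) simp

lemma mat_mult_adj:
  assumes a: "supported F (a :: ('n::finite) matrix)" and b: "supported F b"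
  shows "(\<lambda>s t. cnj (mat_mult a b t s)) = mat_mult (\<lambda>s t. cnj (b t s)) (\<lambda>s t. cnj (a t s))"
proof (intro ext)
  fix s t
  show "cnj (mat_mult a b t s) = mat_mult (\<lambda>s t. cnj (b t s)) (\<lambda>s t. cnj (a t s)) s t"
  proof (cases "t \<in> nbhd F s")
    case True
    show ?thesis
      unfolding mat_mult_eq[OF a] mat_mult_eq[OF supported_adj[OF b]] nbhd_cong[OF True]
      by (simp add: mult.commute)
  next
    case False
    then have "s \<notin> nbhd F t" by (simp add: nbhd_sym[of s])
    from supported_0[OF supported_mult[OF a b] this]
      supported_0[OF supported_mult[OF supported_adj[OF b] supported_adj[OF a]] False]
    show ?thesis by simp
  qed
qed

definition local_matrices :: "'n matrix set" where
  "local_matrices = {local_matrix F m |F m. finite F}"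

lemma local_iff: "a \<in> local_matrices \<longleftrightarrow> (\<exists>F. supported F a)"
  by (auto simp: supported_iff local_matrices_def)

typedef ('n::finite) local_algebra = "local_matrices :: 'n matrix set"
  morphisms entries local_of_matrix
  by (auto simp: local_iff intro: supported_zero)

setup_lifting type_definition_local_algebra

lemma supported_common:
  assumes "a \<in> local_matrices" "b \<in> local_matrices"
  shows "\<exists>F. supported F a \<and> supported F b"
proof -
  from assms obtain F G where *: "supported F a" "supported G b" by (auto simp: local_iff)
  then have "finite (F \<union> G)" by (simp add: supported_finite)
  with supported_mono[OF *(1), of "F \<union> G"] supported_mono[OF *(2), of "F \<union> G"]
  show ?thesis by blast
qed

instantiation local_algebra :: (finite) pre_cstar_algebra
begin

lift_definition zero_local_algebra :: "'a local_algebra" is "\<lambda>s t. 0"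
  unfolding local_iff by (blast intro: supported_zero)

lift_definition one_local_algebra :: "'a local_algebra" is "\<lambda>s t. if s = t then 1 else 0"
  unfolding local_iff by (blast intro: supported_one)

lift_definition plus_local_algebra :: "'a local_algebra \<Rightarrow> 'a local_algebra \<Rightarrow> 'a local_algebra"
  is "\<lambda>a b s t. a s t + b s t"
  by (drule (1) supported_common) (auto simp: local_iff intro: supported_add)

lift_definition times_local_algebra :: "'a local_algebra \<Rightarrow> 'a local_algebra \<Rightarrow> 'a local_algebra"
  is mat_mult
  by (drule (1) supported_common) (auto simp: local_iff intro: supported_mult)

lift_definition scaleC_local_algebra :: "complex \<Rightarrow> 'a local_algebra \<Rightarrow> 'a local_algebra"
  is "\<lambda>c a s t. c * a s t"
  by (auto simp: local_iff intro: supported_scale)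

lift_definition star_local_algebra :: "'a local_algebra \<Rightarrow> 'a local_algebra"
  is "\<lambda>a s t. cnj (a t s)"
  by (auto simp: local_iff intro: supported_adj)

lift_definition norm_local_algebra :: "'a local_algebra \<Rightarrow> real" is op_norm .

definition uminus_local_algebra :: "'a local_algebra \<Rightarrow> 'a local_algebra"
  where "- x = (- 1) *\<^sub>C (x :: 'a local_algebra)"

definition minus_local_algebra :: "'a local_algebra \<Rightarrow> 'a local_algebra \<Rightarrow> 'a local_algebra"
  where "x - y = x + - (y :: 'a local_algebra)"

definition scaleR_local_algebra :: "real \<Rightarrow> 'a local_algebra \<Rightarrow> 'a local_algebra"
  where "r *\<^sub>R x = complex_of_real r *\<^sub>C (x :: 'a local_algebra)"

definition sgn_local_algebra :: "'a local_algebra \<Rightarrow> 'a local_algebra"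
  where "sgn x = inverse (norm x) *\<^sub>R (x :: 'a local_algebra)"

definition dist_local_algebra :: "'a local_algebra \<Rightarrow> 'a local_algebra \<Rightarrow> real"
  where "dist x y = norm (x - y :: 'a local_algebra)"

definition uniformity_local_algebra :: "('a local_algebra \<times> 'a local_algebra) filter"
  where "uniformity_local_algebra = (INF e\<in>{0<..}. principal {(x, y). dist x y < e})"

definition open_local_algebra :: "'a local_algebra set \<Rightarrow> bool"
  where "open_local_algebra U \<longleftrightarrow> (\<forall>x\<in>U. \<forall>\<^sub>F (x', y) in uniformity. x' = x \<longrightarrow> y \<in> U)"

instance
proof
  have sup: "\<exists>F. supported F (entries x)" for x :: "'a local_algebra"
    using entries[of x] by (simp add: local_iff)
  have sup2: "\<exists>F. supported F (entries x) \<and> supported F (entries y)" for x y :: "'a local_algebra"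
    using entries[of x] entries[of y] by (intro supported_common) auto
  fix x y z :: "'a local_algebra" and a b :: complex and r s :: real and U :: "'a local_algebra set"
  show "x + y + z = x + (y + z)" "x + y = y + x" "0 + x = x"
    by (transfer, simp add: add_ac)+
  show "- x + x = 0"
    unfolding uminus_local_algebra_def by transfer simp
  show "x - y = x + - y"
    by (fact minus_local_algebra_def)
  show "x * y * z = x * (y * z)"
    by transfer (drule (1) supported_common, auto intro: mat_mult_assoc)
  show "(x + y) * z = x * z + y * z"
    by transfer (drule (1) supported_common, auto intro: mat_mult_add_left)
  show "x * (y + z) = x * y + x * z"
    by transfer (simp add: mat_mult_def distrib_left sum.distrib)
  show "1 * x = x"
  proof transfer
    fix a :: "'a matrix"
    show "mat_mult (\<lambda>s t. if s = t then 1 else 0) a = a"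
      by (intro ext) (simp add: mat_mult_eq[OF supported_one] nbhd_empty)
  qed
  show "x * 1 = x"
  proof -
    obtain F where F: "supported F (entries x)" using sup by blast
    have "(\<Sum>u\<in>nbhd F s. entries x s u * (if u = t then 1 else 0)) = entries x s t" for s t
      using supported_0[OF F, of t s] finite_nbhd(1)[OF supported_finite[OF F], of s]
      by (cases "t \<in> nbhd F s") (simp_all add: if_distrib sum.delta cong: if_cong)
    then have "mat_mult (entries x) (\<lambda>s t. if s = t then 1 else 0) = entries x"
      by (intro ext) (simp only: mat_mult_eq[OF F])
    then show ?thesis by transfer
  qed
  show "(0 :: 'a local_algebra) \<noteq> 1"
    by transfer (auto simp: fun_eq_iff)
  have C1: "a *\<^sub>C (x + y) = a *\<^sub>C x + a *\<^sub>C y" for a and x y :: "'a local_algebra"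
    by transfer (simp add: distrib_left)
  have C2: "(a + b) *\<^sub>C x = a *\<^sub>C x + b *\<^sub>C x" for a b and x :: "'a local_algebra"
    by transfer (simp add: distrib_right)
  have C3: "a *\<^sub>C b *\<^sub>C x = (a * b) *\<^sub>C x" for a b and x :: "'a local_algebra"
    by transfer (simp add: mult.assoc)
  have C4: "1 *\<^sub>C x = x" for x :: "'a local_algebra"
    by transfer simp
  have C5: "norm (a *\<^sub>C x) = cmod a * norm x" for a and x :: "'a local_algebra"
    by transfer (auto simp: local_iff op_norm_scale)
  have M1: "(a *\<^sub>C x) * y = a *\<^sub>C (x * y)" for a and x y :: "'a local_algebra"
    by transfer (drule (1) supported_common, auto intro: mat_mult_scale_left)
  have M2: "x * (a *\<^sub>C y) = a *\<^sub>C (x * y)" for a and x y :: "'a local_algebra"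
    by transfer (simp add: mat_mult_def sum_distrib_left mult_ac)
  show "a *\<^sub>C (x + y) = a *\<^sub>C x + a *\<^sub>C y" "(a + b) *\<^sub>C x = a *\<^sub>C x + b *\<^sub>C x"
    "a *\<^sub>C b *\<^sub>C x = (a * b) *\<^sub>C x" "norm (a *\<^sub>C x) = cmod a * norm x"
    "(a *\<^sub>C x) * y = a *\<^sub>C (x * y)" "x * (a *\<^sub>C y) = a *\<^sub>C (x * y)"
    by (fact C1 C2 C3 C5 M1 M2)+
  show "r *\<^sub>R x = complex_of_real r *\<^sub>C x"
    by (fact scaleR_local_algebra_def)
  show "r *\<^sub>R (x + y) = r *\<^sub>R x + r *\<^sub>R y" "(r + s) *\<^sub>R x = r *\<^sub>R x + s *\<^sub>R x"
    "r *\<^sub>R s *\<^sub>R x = (r * s) *\<^sub>R x" "1 *\<^sub>R x = x"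
    "(r *\<^sub>R x) * y = r *\<^sub>R (x * y)" "x * (r *\<^sub>R y) = r *\<^sub>R (x * y)"
    by (simp_all add: scaleR_local_algebra_def C1 C2 C3 C4 M1 M2)
  show "dist x y = norm (x - y)"
    by (fact dist_local_algebra_def)
  show "sgn x = inverse (norm x) *\<^sub>R x"
    by (fact sgn_local_algebra_def)
  show "uniformity = (INF e\<in>{0 <..}. principal {(x, y :: 'a local_algebra). dist x y < e})"
    by (fact uniformity_local_algebra_def)
  show "open U \<longleftrightarrow> (\<forall>x\<in>U. \<forall>\<^sub>F (x', y) in uniformity. x' = x \<longrightarrow> y \<in> U)"
    by (fact open_local_algebra_def)
  have N0: "norm (0 :: 'a local_algebra) = 0"
    using C5[of 0 0] by transfer simp
  have N1: "x = 0" if "norm x = 0"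
    using that by transfer (auto simp: local_iff dest: op_norm_eq_0)
  show "norm x = 0 \<longleftrightarrow> x = 0"
    using N0 N1 by blast
  show "norm (x + y) \<le> norm x + norm y"
    by transfer (drule (1) supported_common, auto intro: op_norm_triangle)
  show "norm (r *\<^sub>R x) = \<bar>r\<bar> * norm x"
    by (simp add: scaleR_local_algebra_def C5)
  show "norm (x * y) \<le> norm x * norm y"
    by transfer (drule (1) supported_common, auto intro: op_norm_mult)
  show "norm (1 :: 'a local_algebra) = 1"
    by transfer (rule op_norm_one)
  show "star (star x) = x" "star (x + y) = star x + star y" "star (a *\<^sub>C x) = cnj a *\<^sub>C star x"
    by (transfer, simp)+
  show "star (x * y) = star y * star x"
    by transfer (drule (1) supported_common, auto intro: mat_mult_adj)
  show "norm (star x * x) = (norm x)\<^sup>2"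
    by transfer (auto simp: local_iff op_norm_cstar)
qed

end

lemma l2norm_reindex:
  assumes "bij \<tau>"
  shows "l2norm (\<lambda>s. x (\<tau> s)) = l2norm x"
proof -
  have "bij_betw \<tau> {s. x (\<tau> s) \<noteq> 0} {t. x t \<noteq> 0}"
    using assms by (auto simp: bij_betw_def inj_on_def bij_def image_iff)
  then show ?thesis
    unfolding l2norm_def L2_set_def
    by (intro arg_cong[of _ _ sqrt]) (rule sum.reindex_bij_betw[of \<tau> _ _ "\<lambda>t. (cmod (x t))\<^sup>2"])
qed

lemma finsupp_reindex:
  assumes "bij \<tau>" "finsupp x"
  shows "finsupp (\<lambda>s. x (\<tau> s))"
  using finite_vimageI[of "{t. x t \<noteq> 0}" \<tau>] assms by (simp add: finsupp_def bij_def vimage_def)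

lemma matvec_reindex:
  assumes "bij \<tau>"
  shows "matvec (\<lambda>s t. a (\<tau> s) (\<tau> t)) (\<lambda>s. x (\<tau> s)) = (\<lambda>s. matvec a x (\<tau> s))"
proof
  fix s
  have "bij_betw \<tau> {s. x (\<tau> s) \<noteq> 0} {t. x t \<noteq> 0}"
    using assms by (auto simp: bij_betw_def inj_on_def bij_def image_iff)
  then show "matvec (\<lambda>s t. a (\<tau> s) (\<tau> t)) (\<lambda>s. x (\<tau> s)) s = matvec a x (\<tau> s)"
    unfolding matvec_def by (rule sum.reindex_bij_betw[of \<tau> _ _ "\<lambda>t. a (\<tau> s) t * x t"])
qed

lemma mat_mult_reindex:
  assumes "bij \<tau>"
  shows "mat_mult (\<lambda>s t. a (\<tau> s) (\<tau> t)) (\<lambda>s t. b (\<tau> s) (\<tau> t)) = (\<lambda>s t. mat_mult a b (\<tau> s) (\<tau> t))"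
proof (intro ext)
  fix s t
  have "bij_betw \<tau> {u. a (\<tau> s) (\<tau> u) \<noteq> 0} {u. a (\<tau> s) u \<noteq> 0}"
    using assms by (auto simp: bij_betw_def inj_on_def bij_def image_iff)
  then show "mat_mult (\<lambda>s t. a (\<tau> s) (\<tau> t)) (\<lambda>s t. b (\<tau> s) (\<tau> t)) s t = mat_mult a b (\<tau> s) (\<tau> t)"
    unfolding mat_mult_def by (rule sum.reindex_bij_betw[of \<tau> _ _ "\<lambda>u. a (\<tau> s) u * b u (\<tau> t)"])
qed

lemma op_norm_reindex_le:
  assumes \<tau>: "bij (\<tau> :: 'n config \<Rightarrow> 'n config)" and a: "supported F (a :: ('n::finite) matrix)"
  shows "op_norm (\<lambda>s t. a (\<tau> s) (\<tau> t)) \<le> op_norm a"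
proof (rule op_norm_le)
  show "0 \<le> op_norm a" by (rule op_norm_nonneg[OF a])
  fix x :: "'n config \<Rightarrow> complex" assume x: "finsupp x"
  define y where "y = (\<lambda>t. x (inv \<tau> t))"
  have y: "finsupp y" "l2norm y = l2norm x"
    unfolding y_def
    by (rule finsupp_reindex[OF bij_imp_bij_inv[OF \<tau>] x], rule l2norm_reindex[OF bij_imp_bij_inv[OF \<tau>]])
  have "x = (\<lambda>s. y (\<tau> s))" using \<tau> by (simp add: y_def bij_def)
  then have "l2norm (matvec (\<lambda>s t. a (\<tau> s) (\<tau> t)) x) = l2norm (matvec a y)"
    by (simp add: matvec_reindex[OF \<tau>] l2norm_reindex[OF \<tau>])
  with op_norm_bound[OF a y(1)] y(2)
  show "l2norm (matvec (\<lambda>s t. a (\<tau> s) (\<tau> t)) x) \<le> op_norm a * l2norm x" by simp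
qed

lemma bij_translate: "bij (\<lambda>(s :: 'n config) k. s (k + j))"
  by (rule o_bij[where g = "\<lambda>s k. s (k - j)"]) (auto simp: fun_eq_iff)

lemma supported_translate:
  assumes a: "supported F (a :: 'n matrix)"
  shows "supported ((\<lambda>k. k + j) ` F) (\<lambda>s t. a (\<lambda>k. s (k + j)) (\<lambda>k. t (k + j)))"
proof (rule supportedI)
  show "finite ((\<lambda>k. k + j) ` F)" using supported_finite[OF a] by simp
  have *: "k \<in> (\<lambda>k. k + j) ` F \<longleftrightarrow> k - j \<in> F" for k
    by (auto simp: image_iff intro: bexI[of _ "k - j"])
  have iff: "t \<in> nbhd ((\<lambda>k. k + j) ` F) s \<longleftrightarrow> (\<lambda>k. t (k + j)) \<in> nbhd F (\<lambda>k. s (k + j))" for s t :: "'n config"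
    unfolding nbhd_def * by (simp, metis add_diff_cancel diff_add_cancel)
  show "a (\<lambda>k. s (k + j)) (\<lambda>k. t (k + j)) = 0" if "t \<notin> nbhd ((\<lambda>k. k + j) ` F) s" for s t
    using that unfolding iff by (rule supported_0[OF a])
  show "a (\<lambda>k. s (k + j)) (\<lambda>k. t (k + j)) = a (\<lambda>k. s' (k + j)) (\<lambda>k. t' (k + j))"
    if "t \<in> nbhd ((\<lambda>k. k + j) ` F) s" "t' \<in> nbhd ((\<lambda>k. k + j) ` F) s'"
      "\<forall>k\<in>(\<lambda>k. k + j) ` F. s k = s' k" "\<forall>k\<in>(\<lambda>k. k + j) ` F. t k = t' k" for s t s' t'
    using that unfolding iff by (intro supported_eq[OF a]) auto
qed

text \<open>
  Reading the configurations at \<open>k + j\<close> instead of \<open>k\<close> moves the tensor factor at site \<open>k\<close> to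
  site \<open>k + j\<close>; see \<open>tensor_shift_site\<close> below.
\<close>

lift_definition local_translate :: "int \<Rightarrow> ('n::finite) local_algebra \<Rightarrow> 'n local_algebra"
  is "\<lambda>j a s t. a (\<lambda>k. s (k + j)) (\<lambda>k. t (k + j))"
  unfolding local_iff by (blast intro: supported_translate)

lemma local_translate_0: "local_translate 0 x = x"
  by transfer simp

lemma local_translate_translate: "local_translate i (local_translate j x) = local_translate (i + j) x"
  by transfer (simp add: add_ac)

lemma local_translate_hom:
  fixes x y :: "('n::finite) local_algebra"
  shows
  "local_translate j (x + y) = local_translate j x + local_translate j y"
  "local_translate j (c *\<^sub>C x) = c *\<^sub>C local_translate j x"
  "local_translate j (x * y) = local_translate j x * local_translate j y"
  "local_translate j (star x) = star (local_translate j x)"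
  "local_translate j (1 :: 'n local_algebra) = 1"
proof -
  show "local_translate j (x * y) = local_translate j x * local_translate j y"
    by transfer (simp add: mat_mult_reindex[OF bij_translate])
  show "local_translate j (1 :: 'n local_algebra) = 1"
  proof (transfer, intro ext)
    fix j and s t :: "'n config"
    have "(\<lambda>k. s (k + j)) = (\<lambda>k. t (k + j)) \<longleftrightarrow> s = t"
      using bij_is_inj[OF bij_translate[of j]] by (auto dest: injD)
    then show "(if (\<lambda>k. s (k + j)) = (\<lambda>k. t (k + j)) then 1 else (0::complex)) = (if s = t then 1 else 0)"
      by simp
  qed
qed (transfer, simp)+

lemma norm_local_translate: "norm (local_translate j x) = norm x"
proof -
  have *: "norm (local_translate j x) \<le> norm x" for j and x :: "'a local_algebra"
    by transfer (auto simp: local_iff intro: op_norm_reindex_le[OF bij_translate])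
  from *[of j x] *[of "- j" "local_translate j x"] show ?thesis
    by (simp add: local_translate_translate local_translate_0)
qed

section \<open>The UHF algebra and the tensor product shift\<close>

type_synonym 'n uhf = "'n local_algebra completion"

lift_definition uhf_translate :: "int \<Rightarrow> ('n::finite) uhf \<Rightarrow> 'n uhf"
  is "\<lambda>j X n. local_translate j (X n)"
  by (rule cauchy_rel_bounded_linear)
     (auto intro!: clinear_imp_bounded_linear[of _ 1] simp: clinear_def local_translate_hom norm_local_translate)

definition tensor_shift :: "('n::finite) uhf \<Rightarrow> 'n uhf" where
  "tensor_shift = uhf_translate 1"

text \<open>The embedding of the \<open>p \<times> p\<close> matrices as the tensor factor at site \<open>k\<close>.\<close>

lift_definition local_site :: "int \<Rightarrow> complex^'n^'n \<Rightarrow> ('n::finite) local_algebra"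
  is "\<lambda>k m. local_matrix {k} (\<lambda>s t. m $ s k $ t k)"
  by (auto simp: local_matrices_def)

definition site :: "int \<Rightarrow> complex^'n^'n \<Rightarrow> ('n::finite) uhf" where
  "site k m = to_completion (local_site k m)"

lemma Cauchy_translate: "Cauchy X \<Longrightarrow> Cauchy (\<lambda>n. local_translate j (X n))"
  by (rule bounded_linear.Cauchy[of "local_translate j"])
     (auto intro!: clinear_imp_bounded_linear[of _ 1] simp: clinear_def local_translate_hom norm_local_translate)

lemma star_automorphism_tensor_shift: "star_automorphism (tensor_shift :: ('n::finite) uhf \<Rightarrow> _)"
proof -
  have sC: "Cauchy (\<lambda>n. c *\<^sub>C X n)" if "Cauchy X" for c and X :: "nat \<Rightarrow> 'n local_algebra"
    by (rule bounded_linear.Cauchy[OF bounded_linear_scaleC that])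
  have sS: "Cauchy (\<lambda>n. star (X n))" if "Cauchy X" for X :: "nat \<Rightarrow> 'n local_algebra"
    by (rule bounded_linear.Cauchy[OF bounded_linear_star that])
  have "uhf_translate i (uhf_translate j x) = uhf_translate (i + j) x" "uhf_translate 0 x = x"
    for i j and x :: "'n uhf"
    by (transfer, simp add: local_translate_translate local_translate_0 Cauchy_translate)+
  then have "bij (uhf_translate 1 :: 'n uhf \<Rightarrow> _)"
    by (intro o_bij[where g = "uhf_translate (- 1)"]) (auto simp: fun_eq_iff)
  moreover have "clinear (uhf_translate 1 :: 'n uhf \<Rightarrow> _)"
    unfolding clinear_def
    by (intro conjI allI; transfer; simp add: local_translate_hom sC Cauchy_add Cauchy_translate)
  moreover have "uhf_translate 1 (1 :: 'n uhf) = 1"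
    by transfer (simp add: local_translate_hom Cauchy_const_seq)
  moreover have "uhf_translate 1 (x * y) = uhf_translate 1 x * uhf_translate 1 (y :: 'n uhf)" for x y
    by transfer (simp add: local_translate_hom Cauchy_mult Cauchy_translate)
  moreover have "uhf_translate 1 (star x) = star (uhf_translate 1 (x :: 'n uhf))" for x
    by transfer (simp add: local_translate_hom sS Cauchy_translate)
  ultimately show ?thesis by (simp add: star_automorphism_def tensor_shift_def)
qed

lemma isometric_automorphism_tensor_shift:
  "isometric_automorphism (tensor_shift :: ('n::finite) uhf \<Rightarrow> _)"
proof -
  have "norm (uhf_translate 1 x) = norm x" for x :: "'n uhf"
    by transfer (simp add: norm_local_translate)
  with star_automorphism_tensor_shift show ?thesis
    by (auto simp: star_automorphism_def isometric_automorphism_def isometric_def tensor_shift_def bij_def)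
qed

lemma tensor_shift_site: "tensor_shift (site k m) = site (k + 1) m"
proof -
  have "local_translate 1 (local_site k m) = local_site (k + 1) m"
  proof (transfer, intro ext)
    fix k and m :: "complex^'a^'a" and s t :: "'a config"
    have "(\<forall>i. i \<notin> {k} \<longrightarrow> s (i + 1) = t (i + 1)) \<longleftrightarrow> (\<forall>i. i \<notin> {k + 1} \<longrightarrow> s i = t i)"
      by (metis add_diff_cancel diff_add_cancel singleton_iff)
    moreover have "local_matrix {k} (\<lambda>s t. m $ s k $ t k) (\<lambda>k. s (k + 1)) (\<lambda>k. t (k + 1))
        = (if \<forall>i. i \<notin> {k} \<longrightarrow> s (i + 1) = t (i + 1) then m $ s (k + 1) $ t (k + 1) else 0)"
      by (auto simp: local_matrix_def)
    moreover have "local_matrix {k + 1} (\<lambda>s t. m $ s (k + 1) $ t (k + 1)) s t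
        = (if \<forall>i. i \<notin> {k + 1} \<longrightarrow> s i = t i then m $ s (k + 1) $ t (k + 1) else 0)"
      by (auto simp: local_matrix_def)
    ultimately show "local_matrix {k} (\<lambda>s t. m $ s k $ t k) (\<lambda>k. s (k + 1)) (\<lambda>k. t (k + 1))
        = local_matrix {k + 1} (\<lambda>s t. m $ s (k + 1) $ t (k + 1)) s t"
      by (simp only:)
  qed
  moreover have "tensor_shift (to_completion x) = to_completion (local_translate 1 x)" for x :: "'a local_algebra"
    unfolding tensor_shift_def by transfer (simp add: Cauchy_const_seq)
  ultimately show ?thesis by (simp add: site_def)
qed

lemma supported_site: "supported {k} (local_matrix {k} m)"
  by (auto simp: supported_iff)

lemma local_site_hom:
  fixes m m' :: "complex^'n^'n"
  shows "local_site k (m + m') = local_site k m + local_site k m'"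
    "local_site k (m ** m') = local_site k m * local_site k m'"
    "local_site k (mat 1 :: complex^'n^'n) = 1"
    "local_site k (\<chi> i j. cnj (m $ j $ i)) = star (local_site k m)"
proof -
  show "local_site k (m + m') = local_site k m + local_site k m'"
    "local_site k (\<chi> i j. cnj (m $ j $ i)) = star (local_site k m)"
    by (transfer; auto simp: local_matrix_def fun_eq_iff)+
  show "local_site k (mat 1 :: complex^'n^'n) = 1"
  proof (transfer, intro ext)
    fix k and s t :: "'n config"
    show "local_matrix {k} (\<lambda>s t. mat 1 $ s k $ t k) s t = (if s = t then 1 else (0::complex))"
    proof (cases "s = t")
      case False
      then obtain i where "s i \<noteq> t i" by blast
      then show ?thesis using False by (cases "i = k") (auto simp: local_matrix_def mat_def)
    qed (simp add: local_matrix_def mat_def)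
  qed
  show "local_site k (m ** m') = local_site k m * local_site k m'"
  proof (transfer, intro ext)
    fix k and m m' :: "complex^'n^'n" and s t :: "'n config"
    let ?M = "\<lambda>m :: complex^'n^'n. local_matrix {k} (\<lambda>s t. m $ s k $ t k)"
    show "?M (m ** m') s t = mat_mult (?M m) (?M m') s t"
    proof (cases "t \<in> nbhd {k} s")
      case True
      have "mat_mult (?M m) (?M m') s t = (\<Sum>u\<in>nbhd {k} s. ?M m s u * ?M m' u t)"
        by (rule mat_mult_eq[OF supported_site])
      also have "\<dots> = (\<Sum>i\<in>UNIV. m $ s k $ i * m' $ i $ t k)"
        by (rule sum.reindex_bij_witness[where i = "\<lambda>i. s(k := i)" and j = "\<lambda>u. u k"])
           (use True in \<open>auto simp: nbhd_def local_matrix_def\<close>)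
      also have "\<dots> = ?M (m ** m') s t"
        using True by (simp add: local_matrix_def nbhd_def matrix_matrix_mult_def)
      finally show ?thesis ..
    next
      case False
      show ?thesis
        by (simp only: supported_0[OF supported_site False]
            supported_0[OF supported_mult[OF supported_site supported_site] False])
    qed
  qed
qed

lemma local_site_commute:
  assumes "j \<noteq> k"
  shows "local_site j m * local_site k m' = local_site k m' * local_site j m"
  using assms
proof (transfer, intro ext)
  fix j k :: int and m m' :: "complex^'n^'n" and s t :: "'n config"
  assume jk: "j \<noteq> k"
  let ?M = "\<lambda>k. \<lambda>m :: complex^'n^'n. local_matrix {k} (\<lambda>s t. m $ s k $ t k)"
  have *: "mat_mult (?M j m) (?M k m') s t =
      (if \<forall>i. i \<notin> {j, k} \<longrightarrow> s i = t i then m $ s j $ t j * m' $ s k $ t k else 0)"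
    if jk: "j \<noteq> k" for j k m m'
  proof -
    have "mat_mult (?M j m) (?M k m') s t = (\<Sum>u\<in>nbhd {j} s. ?M j m s u * ?M k m' u t)"
      by (rule mat_mult_eq[OF supported_site])
    also have "\<dots> = (\<Sum>u\<in>{s(j := t j)}. ?M j m s u * ?M k m' u t)"
    proof (rule sum.mono_neutral_right)
      show "finite (nbhd {j} s)" by (simp add: finite_nbhd)
      show "\<forall>u\<in>nbhd {j} s - {s(j := t j)}. ?M j m s u * ?M k m' u t = 0"
      proof
        fix u assume u: "u \<in> nbhd {j} s - {s(j := t j)}"
        have "u j \<noteq> t j"
        proof
          assume "u j = t j"
          with u have "u = s(j := t j)" by (intro ext) (auto simp: nbhd_def)
          with u show False by simp
        qed
        then have "\<not> (\<forall>i. i \<notin> {k} \<longrightarrow> u i = t i)" using jk by auto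
        then show "?M j m s u * ?M k m' u t = 0" by (auto simp: local_matrix_def)
      qed
    qed (auto simp: nbhd_def)
    also have "\<dots> = (if \<forall>i. i \<notin> {j, k} \<longrightarrow> s i = t i then m $ s j $ t j * m' $ s k $ t k else 0)"
      using jk by (auto simp: local_matrix_def)
    finally show ?thesis .
  qed
  show "mat_mult (?M j m) (?M k m') s t = mat_mult (?M k m') (?M j m) s t"
    unfolding *[OF jk] *[OF jk[symmetric]] by (auto simp: mult.commute)
qed

section \<open>Existence of a CA embedding\<close>

instantiation bcontfun :: (topological_space, complex_normed_vector) complex_normed_vector
begin

definition scaleC_bcontfun :: "complex \<Rightarrow> ('a \<Rightarrow>\<^sub>C 'b) \<Rightarrow> 'a \<Rightarrow>\<^sub>C 'b" where
  "scaleC_bcontfun c f = Bcontfun (\<lambda>x. c *\<^sub>C apply_bcontfun f x)"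

lemma apply_scaleC [simp]: "apply_bcontfun (c *\<^sub>C f) x = c *\<^sub>C apply_bcontfun f x"
  for f :: "'a \<Rightarrow>\<^sub>C 'b"
proof -
  have "continuous_on UNIV (\<lambda>x. c *\<^sub>C apply_bcontfun f x)"
    by (rule bounded_linear.continuous_on[OF bounded_linear_scaleC]) simp
  moreover have "bounded (range (\<lambda>x. c *\<^sub>C apply_bcontfun f x))"
    using bounded_linear_image[OF bounded_apply_bcontfun[of f] bounded_linear_scaleC[of c]]
    by (simp add: image_image)
  ultimately have "(\<lambda>x. c *\<^sub>C apply_bcontfun f x) \<in> bcontfun" by (simp add: bcontfun_def)
  then show ?thesis by (simp add: scaleC_bcontfun_def Bcontfun_inverse)
qed

instance
proof
  fix r :: real and a b :: complex and f g :: "'a \<Rightarrow>\<^sub>C 'b"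
  show "r *\<^sub>R f = complex_of_real r *\<^sub>C f"
    by (rule bcontfun_eqI) (simp add: scaleR_scaleC)
  show "a *\<^sub>C (f + g) = a *\<^sub>C f + a *\<^sub>C g" "(a + b) *\<^sub>C f = a *\<^sub>C f + b *\<^sub>C f"
    "a *\<^sub>C b *\<^sub>C f = (a * b) *\<^sub>C f"
    by (rule bcontfun_eqI, simp add: scaleC_add_right scaleC_add_left scaleC_scaleC)+
  have le: "norm (c *\<^sub>C h) \<le> cmod c * norm h" for c and h :: "'a \<Rightarrow>\<^sub>C 'b"
  proof (rule norm_bound)
    fix x
    show "norm (apply_bcontfun (c *\<^sub>C h) x) \<le> cmod c * norm h"
      by (simp add: norm_scaleC mult_left_mono norm_bounded)
  qed
  show "norm (a *\<^sub>C f) = cmod a * norm f"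
  proof (cases "a = 0")
    case True
    with le[of 0 f] show ?thesis by simp
  next
    case False
    have "f = inverse a *\<^sub>C a *\<^sub>C f"
      by (rule bcontfun_eqI) (use False in \<open>simp add: scaleC_scaleC\<close>)
    then have "norm f \<le> inverse (cmod a) * norm (a *\<^sub>C f)"
      using le[of "inverse a" "a *\<^sub>C f"] by (simp add: norm_inverse)
    then have "cmod a * norm f \<le> norm (a *\<^sub>C f)"
      using False by (simp add: field_simps)
    with le[of a f] show ?thesis by simp
  qed
qed

end

instance bcontfun :: (metric_space, complex_banach) complex_banach ..

instantiation complex :: complex_banach
begin
definition scaleC_complex :: "complex \<Rightarrow> complex \<Rightarrow> complex" where "scaleC_complex = (*)"
instance
  by standard (auto simp: scaleC_complex_def scaleR_conv_of_real norm_mult algebra_simps)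
end

definition dual_ball :: "('a::complex_normed_vector \<Rightarrow> complex) set" where
  "dual_ball = {f. clinear f \<and> (\<forall>x. cmod (f x) \<le> norm x)}"

text \<open>
  Evaluation of \<open>x\<close> on the dual unit ball, regarded as a discrete space. Functions are extended by
  zero because the unit ball is not a type.
\<close>

definition dual_eval :: "'a::complex_normed_vector \<Rightarrow> ('a \<Rightarrow> complex) discrete \<Rightarrow>\<^sub>C complex" where
  "dual_eval x = Bcontfun (\<lambda>f. if of_discrete f \<in> dual_ball then of_discrete f x else 0)"

lemma dual_eval_apply:
  "apply_bcontfun (dual_eval x) f = (if of_discrete f \<in> dual_ball then of_discrete f x else 0)"
proof -
  let ?h = "\<lambda>f. if of_discrete f \<in> dual_ball then of_discrete f x else 0"
  have "continuous_on UNIV ?h"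
    by (simp add: continuous_on_open_vimage open_discrete)
  moreover have "bounded (range ?h)"
    by (rule boundedI[of _ "norm x"]) (auto simp: dual_ball_def)
  ultimately have "?h \<in> bcontfun" by (simp add: bcontfun_def)
  then show ?thesis by (simp add: dual_eval_def Bcontfun_inverse)
qed

lemma clinear_dual_eval: "clinear dual_eval"
  unfolding clinear_def
  by (intro conjI allI; rule bcontfun_eqI)
     (auto simp: dual_eval_apply dual_ball_def clinear_def scaleC_complex_def)

lemma norm_dual_eval_le: "norm (dual_eval x) \<le> norm x"
  by (rule norm_bound) (auto simp: dual_eval_apply dual_ball_def)

lemma norm_dual_eval_ge: "f \<in> dual_ball \<Longrightarrow> cmod (f x) \<le> norm (dual_eval x)"
  using norm_bounded[of "dual_eval x" "discrete f"] by (simp add: dual_eval_apply discrete_inverse)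

lemma linf_norm_le:
  assumes "d > 0" "\<And>i. i < d \<Longrightarrow> cmod (v i) \<le> K"
  shows "linf_norm d v \<le> K"
  unfolding linf_norm_def using assms by (subst Max_le_iff) auto

lemma le_linf_norm: "i < d \<Longrightarrow> cmod (v i) \<le> linf_norm d v"
  unfolding linf_norm_def by (intro Max_ge) auto

lemma CA_dual_eval:
  fixes \<Omega> :: "'a::complex_normed_vector set"
  assumes fin: "finite \<Omega>" and "\<delta> > 0"
  shows "CA dual_eval \<Omega> \<delta> \<noteq> {}"
proof -
  define \<eta> where "\<eta> = \<delta> / 4"
  have \<eta>: "\<eta> > 0" using assms by (simp add: \<eta>_def)
  define code where "code = (\<lambda>f. restrict (\<lambda>x. (\<lfloor>Re (apply_bcontfun (dual_eval x) f) / \<eta>\<rfloor>, \<lfloor>Im (apply_bcontfun (dual_eval x) f) / \<eta>\<rfloor>)) \<Omega>)"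
  define C where "C = range code"
  have "finite C"
  proof (rule finite_subset)
    let ?I = "\<lambda>x. {\<lfloor>- norm x / \<eta>\<rfloor>..\<lfloor>norm x / \<eta>\<rfloor>}"
    have "(\<lfloor>Re (apply_bcontfun (dual_eval x) f) / \<eta>\<rfloor>, \<lfloor>Im (apply_bcontfun (dual_eval x) f) / \<eta>\<rfloor>) \<in> ?I x \<times> ?I x" for x f
    proof -
      have "cmod (apply_bcontfun (dual_eval x) f) \<le> norm x"
        using norm_bounded norm_dual_eval_le order_trans by blast
      then have "\<bar>Re (apply_bcontfun (dual_eval x) f)\<bar> \<le> norm x" "\<bar>Im (apply_bcontfun (dual_eval x) f)\<bar> \<le> norm x"
        using abs_Re_le_cmod abs_Im_le_cmod order_trans by blast+
      then have "- norm x / \<eta> \<le> r / \<eta> \<and> r / \<eta> \<le> norm x / \<eta>"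
        if "r = Re (apply_bcontfun (dual_eval x) f) \<or> r = Im (apply_bcontfun (dual_eval x) f)" for r
        using \<eta> that by (intro conjI divide_right_mono) auto
      then show ?thesis
        by (simp only: mem_Times_iff fst_conv snd_conv atLeastAtMost_iff) (blast intro: floor_mono)
    qed
    then show "C \<subseteq> PiE \<Omega> (\<lambda>x. ?I x \<times> ?I x)"
      unfolding C_def code_def by (intro image_subsetI restrict_PiE_iff[THEN iffD2] ballI)
    show "finite (PiE \<Omega> (\<lambda>x. ?I x \<times> ?I x))"
      using fin by (intro finite_PiE) auto
  qed
  define d where "d = card C"
  have d: "d > 0" using \<open>finite C\<close> by (auto simp: d_def C_def card_gt_0_iff)
  obtain e where e: "bij_betw e {..<d} C"
    using ex_bij_betw_nat_finite[OF \<open>finite C\<close>] by (auto simp: d_def atLeast0LessThan)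
  define idx where "idx = (\<lambda>f. the_inv_into {..<d} e (code f))"
  have idx: "idx f < d" "e (idx f) = code f" for f
    using e the_inv_into_into[of e "{..<d}" "code f" "{..<d}"] f_the_inv_into_f[of e "{..<d}" "code f"]
    by (auto simp: idx_def bij_betw_def C_def)
  have "\<forall>i<d. \<exists>f. code f = e i"
    using e by (metis C_def bij_betw_apply lessThan_iff rangeE)
  then obtain p where p: "\<And>i. i < d \<Longrightarrow> code (p i) = e i" by metis
  define \<phi> where "\<phi> = (\<lambda>x i. if i < d then apply_bcontfun (dual_eval x) (p i) else 0)"
  define \<psi> where "\<psi> = (\<lambda>v :: nat \<Rightarrow> complex. Bcontfun (\<lambda>f :: ('a \<Rightarrow> complex) discrete. v (idx f)))"
  have \<psi>: "apply_bcontfun (\<psi> v) f = v (idx f)" for v f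
  proof -
    have "bounded (range (\<lambda>f. v (idx f)))"
    proof (rule finite_imp_bounded, rule finite_subset)
      show "range (\<lambda>f. v (idx f)) \<subseteq> v ` {..<d}" using idx(1) by auto
    qed simp
    then have "(\<lambda>f. v (idx f)) \<in> bcontfun"
      by (simp add: bcontfun_def continuous_on_open_vimage open_discrete)
    then show ?thesis by (simp add: \<psi>_def Bcontfun_inverse)
  qed
  have lin: "dual_eval (x + y) = dual_eval x + dual_eval y" "dual_eval (c *\<^sub>C x) = c *\<^sub>C dual_eval x" for x y :: 'a and c
    using clinear_dual_eval by (auto simp: clinear_def)
  have "contraction_to_linf d \<phi>"
    unfolding contraction_to_linf_def
  proof (intro conjI allI)
    fix x y :: 'a and c
    show "\<phi> x \<in> linf d" by (simp add: \<phi>_def linf_def)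
    show "\<phi> (x + y) = (\<lambda>i. \<phi> x i + \<phi> y i)" by (auto simp: \<phi>_def lin fun_eq_iff)
    show "\<phi> (c *\<^sub>C x) = (\<lambda>i. c * \<phi> x i)"
      by (auto simp: \<phi>_def lin fun_eq_iff scaleC_complex_def)
    show "linf_norm d (\<phi> x) \<le> norm x"
      using norm_bounded norm_dual_eval_le order_trans by (intro linf_norm_le[OF d]) (fastforce simp: \<phi>_def)
  qed
  moreover have "contraction_from_linf d \<psi>"
    unfolding contraction_from_linf_def
    by (auto intro!: bcontfun_eqI norm_bound
        simp: \<psi> scaleC_complex_def le_linf_norm idx)
  moreover have "norm (\<psi> (\<phi> x) - dual_eval x) < \<delta>" if x: "x \<in> \<Omega>" for x
  proof -
    have "norm (\<psi> (\<phi> x) - dual_eval x) \<le> \<delta> / 2"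
    proof (rule norm_bound)
      fix f
      define u v where "u = apply_bcontfun (dual_eval x) (p (idx f))" and "v = apply_bcontfun (dual_eval x) f"
      have "code (p (idx f)) = code f" using p idx by simp
      from fun_cong[OF this, of x] x have fl: "\<lfloor>Re u / \<eta>\<rfloor> = \<lfloor>Re v / \<eta>\<rfloor>" "\<lfloor>Im u / \<eta>\<rfloor> = \<lfloor>Im v / \<eta>\<rfloor>"
        by (simp_all add: code_def u_def v_def)
      have close: "\<bar>r - s\<bar> \<le> \<eta>" if "\<lfloor>r / \<eta>\<rfloor> = \<lfloor>s / \<eta>\<rfloor>" for r s
      proof -
        have "\<bar>r / \<eta> - s / \<eta>\<bar> \<le> 1" using that by linarith
        then show ?thesis using \<eta> by (simp add: divide_le_eq flip: diff_divide_distrib)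
      qed
      have "cmod (u - v) \<le> \<bar>Re (u - v)\<bar> + \<bar>Im (u - v)\<bar>" by (rule cmod_le)
      also have "\<dots> \<le> \<eta> + \<eta>" using close[OF fl(1)] close[OF fl(2)] by simp
      finally have "cmod (u - v) \<le> \<delta> / 2" by (simp add: \<eta>_def)
      then show "norm (apply_bcontfun (\<psi> (\<phi> x) - dual_eval x) f) \<le> \<delta> / 2"
        by (simp add: \<psi> \<phi>_def idx(1) u_def v_def)
    qed
    then show ?thesis using assms(2) by simp
  qed
  ultimately have "(\<phi>, \<psi>, d) \<in> CA dual_eval \<Omega> \<delta>"
    using d by (simp add: CA_def)
  then show ?thesis by blast
qed

lemma extend_functional:
  fixes f :: "'a::pre_cstar_algebra \<Rightarrow> complex"
  assumes f: "clinear f" "\<And>x. cmod (f x) \<le> norm x"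
  shows "\<exists>g\<in>dual_ball. \<forall>x. g (to_completion x) = f x"
proof -
  have diff: "f (x - y) = f x - f y" for x y
    using f(1) unfolding clinear_def
    by (metis add_diff_cancel_right' diff_add_cancel)
  have "\<exists>X. (\<lambda>n. to_completion (X n)) \<longlonglongrightarrow> x" for x :: "'a completion"
    by (induct x rule: completion.abs_induct) (auto intro: to_completion_tendsto)
  then obtain X where X: "\<And>x :: 'a completion. (\<lambda>n. to_completion (X x n)) \<longlonglongrightarrow> x" by metis
  have CX: "Cauchy Y" if "(\<lambda>n. to_completion (Y n)) \<longlonglongrightarrow> x" for Y and x :: "'a completion"
    using LIMSEQ_imp_Cauchy[OF that] unfolding Cauchy_iff by (simp add: norm_to_completion flip: to_completion_diff)
  have conv: "convergent (\<lambda>n. f (Y n))" if "(\<lambda>n. to_completion (Y n)) \<longlonglongrightarrow> x" for Y and x :: "'a completion"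
  proof -
    have "bounded_linear f"
      by (rule clinear_imp_bounded_linear[of _ 1]) (use f in auto)
    then have "Cauchy (\<lambda>n. f (Y n))" by (rule bounded_linear.Cauchy) (rule CX[OF that])
    then show ?thesis by (simp add: Cauchy_convergent_iff)
  qed
  define g where "g = (\<lambda>x. lim (\<lambda>n. f (X x n)))"
  have g: "(\<lambda>n. f (Y n)) \<longlonglongrightarrow> g x" if Y: "(\<lambda>n. to_completion (Y n)) \<longlonglongrightarrow> x" for Y x
  proof -
    have "(\<lambda>n. norm (Y n - X x n)) \<longlonglongrightarrow> 0"
      using tendsto_norm[OF tendsto_diff[OF Y X[of x]]] by (simp add: norm_to_completion flip: to_completion_diff)
    then have "(\<lambda>n. f (Y n) - f (X x n)) \<longlonglongrightarrow> 0"
      by (rule Lim_null_comparison[rotated]) (use f(2) in \<open>simp flip: diff\<close>)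
    moreover have "(\<lambda>n. f (X x n)) \<longlonglongrightarrow> g x"
      using conv[OF X] by (simp add: g_def convergent_LIMSEQ_iff)
    ultimately have "(\<lambda>n. (f (Y n) - f (X x n)) + f (X x n)) \<longlonglongrightarrow> 0 + g x"
      by (rule tendsto_add)
    then show ?thesis by simp
  qed
  have "g (x + y) = g x + g y" for x y
  proof -
    have "(\<lambda>n. to_completion (X x n + X y n)) \<longlonglongrightarrow> x + y"
      unfolding to_completion_hom by (intro tendsto_add X)
    from g[OF this] tendsto_add[OF g[OF X] g[OF X]] show ?thesis
      using f(1) by (auto simp: clinear_def intro: LIMSEQ_unique)
  qed
  moreover have "g (c *\<^sub>C x) = c *\<^sub>C g x" for c x
  proof -
    have "(\<lambda>n. to_completion (c *\<^sub>C X x n)) \<longlonglongrightarrow> c *\<^sub>C x"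
      unfolding to_completion_hom by (intro bounded_linear.tendsto[OF bounded_linear_scaleC] X)
    from g[OF this] bounded_linear.tendsto[OF bounded_linear_scaleC g[OF X]] show ?thesis
      using f(1) by (auto simp: clinear_def intro: LIMSEQ_unique)
  qed
  moreover have "cmod (g x) \<le> norm x" for x
  proof (rule LIMSEQ_le)
    show "(\<lambda>n. cmod (f (X x n))) \<longlonglongrightarrow> cmod (g x)" by (intro tendsto_norm g X)
    show "(\<lambda>n. norm (to_completion (X x n))) \<longlonglongrightarrow> norm x" by (intro tendsto_norm X)
  qed (use f(2) in \<open>auto simp: norm_to_completion\<close>)
  moreover have "g (to_completion x) = f x" for x
    by (rule LIMSEQ_unique[OF g[of "\<lambda>_. x"]]) simp_all
  ultimately show ?thesis
    by (intro bexI[of _ g]) (auto simp: dual_ball_def clinear_def)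
qed

lemma local_norming:
  fixes a :: "('n::finite) local_algebra"
  assumes "e > 0"
  shows "\<exists>f. clinear f \<and> (\<forall>b. cmod (f b) \<le> norm b) \<and> norm a - e < cmod (f a)"
proof -
  obtain F where F: "supported F (entries a)" using entries[of a] by (auto simp: local_iff)
  have "\<exists>x. finsupp x \<and> l2norm x \<le> 1 \<and> norm a - e < l2norm (matvec (entries a) x)"
  proof (rule ccontr)
    assume *: "\<not> ?thesis"
    have "op_norm (entries a) \<le> norm a - e"
      unfolding op_norm_def
      by (rule cSUP_least) (use * in \<open>auto simp: not_less intro: exI[of _ "\<lambda>_. 0"]\<close>)
    with assms show False by (simp add: norm_local_algebra.rep_eq)
  qed
  then obtain x where x: "finsupp x" "l2norm x \<le> 1" "norm a - e < l2norm (matvec (entries a) x)" by blast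
  define y where "y = matvec (entries a) x"
  have fy: "finsupp y" unfolding y_def by (rule finsupp_matvec[OF F x(1)])
  define r where "r = inverse (l2norm y)"
  define T where "T = {t. y t \<noteq> 0}"
  have T: "finite T" using fy by (simp add: T_def finsupp_def)
  define f where "f = (\<lambda>b. of_real r * (\<Sum>t\<in>T. cnj (y t) * matvec (entries b) x t))"
  have "clinear f"
    unfolding clinear_def f_def
    by (auto simp: plus_local_algebra.rep_eq scaleC_local_algebra.rep_eq scaleC_complex_def matvec_def
        distrib_left distrib_right sum.distrib sum_distrib_left mult_ac)
  moreover have "cmod (f b) \<le> norm b" for b
  proof -
    obtain G where G: "supported G (entries b)" using entries[of b] by (auto simp: local_iff)
    let ?z = "matvec (entries b) x"
    have fz: "finsupp ?z" by (rule finsupp_matvec[OF G x(1)])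
    have "(\<Sum>t\<in>T. cnj (y t) * ?z t) = (\<Sum>t\<in>T \<union> {t. ?z t \<noteq> 0}. cnj (y t) * ?z t)"
      using T fz by (intro sum.mono_neutral_left) (auto simp: T_def finsupp_def)
    then have "cmod (\<Sum>t\<in>T. cnj (y t) * ?z t) \<le> l2norm y * l2norm ?z"
      using sum_cnj_mult_le[of "T \<union> {t. ?z t \<noteq> 0}" y ?z] T fz by (auto simp: T_def finsupp_def)
    then have "r * cmod (\<Sum>t\<in>T. cnj (y t) * ?z t) \<le> r * (l2norm y * l2norm ?z)"
      by (rule mult_left_mono) (simp add: r_def)
    then have "cmod (f b) \<le> r * (l2norm y * l2norm ?z)"
      by (simp add: f_def norm_mult r_def norm_inverse)
    also have "\<dots> \<le> 1 * l2norm ?z"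
      unfolding mult.assoc[symmetric] by (rule mult_right_mono) (cases "l2norm y = 0"; simp add: r_def)+
    also have "\<dots> \<le> op_norm (entries b) * l2norm x"
      using op_norm_bound[OF G x(1)] by simp
    also have "\<dots> \<le> op_norm (entries b)"
      using x(2) op_norm_nonneg[OF G] by (simp add: mult_left_le)
    finally show ?thesis by (simp add: norm_local_algebra.rep_eq)
  qed
  moreover have "cmod (f a) = l2norm y"
  proof -
    have "f a = of_real r * of_real ((l2norm y)\<^sup>2)"
      unfolding f_def y_def[symmetric] by (subst l2norm_square[OF T]) (auto simp: T_def)
    then have "cmod (f a) = r * (l2norm y)\<^sup>2"
      by (simp add: norm_mult r_def norm_inverse norm_power)
    then show ?thesis by (cases "l2norm y = 0") (simp_all add: r_def power2_eq_square)
  qed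
  ultimately show ?thesis using x(3) unfolding y_def by metis
qed

lemma CA_embedding_dual_eval: "CA_embedding (dual_eval :: ('n::finite) uhf \<Rightarrow> _)"
proof -
  have "norm x \<le> norm (dual_eval x)" for x :: "'n uhf"
  proof (rule field_le_epsilon)
    fix e :: real assume "e > 0"
    then have e: "e / 3 > 0" by simp
    obtain a where a: "norm (x - to_completion a) < e / 3" using to_completion_dense[OF e] by blast
    obtain f where f: "clinear f" "\<And>b. cmod (f b) \<le> norm b" "norm a - e / 3 < cmod (f a)"
      using local_norming[OF e, of a] by blast
    obtain g where g: "g \<in> dual_ball" "\<And>b. g (to_completion b) = f b"
      using extend_functional[OF f(1,2)] by blast
    have "cmod (g (to_completion a)) \<le> cmod (g x) + cmod (g (to_completion a - x))"
    proof -
      have "g (to_completion a) = g x + g (to_completion a - x)"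
        using g(1) unfolding dual_ball_def clinear_def mem_Collect_eq
        by (metis add.commute diff_add_cancel)
      then show ?thesis by (simp add: norm_triangle_ineq)
    qed
    moreover have "cmod (g (to_completion a - x)) \<le> norm (x - to_completion a)"
      using g(1) norm_minus_commute[of x "to_completion a"] by (simp add: dual_ball_def)
    moreover have "norm x \<le> norm a + norm (x - to_completion a)"
      using norm_triangle_ineq[of "to_completion a" "x - to_completion a"] by (simp add: norm_to_completion)
    ultimately show "norm x \<le> norm (dual_eval x) + e"
      using norm_dual_eval_ge[OF g(1), of x] a f(3) g(2)[of a] by simp
  qed
  then have "norm (dual_eval x) = norm x" for x :: "'n uhf"
    by (rule antisym[OF norm_dual_eval_le])
  then show ?thesis
    by (simp add: CA_embedding_def isometric_def clinear_dual_eval CA_dual_eval)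
qed

end

theory Submission
  imports Defs
begin

text \<open>
  States on \<open>n\<close> tensor factors restrict to far more points than a classical system with the same
  number of pure states would give, because each factor has a continuum of pure states. Fix \<open>k\<close>
  pairwise non-parallel unit vectors in one factor and let \<open>y i\<close> be the projection onto the \<open>i\<close>-th
  line. For each of the \<open>k ^ n\<close> words \<open>p\<close>, a product vector is fixed by the projection \<open>y (p j)\<close>
  at every site \<open>j < n\<close>, so the sum of these projections has norm \<open>n\<close>
  (\<open>norm_sum_of_projections_at_distinct_sites\<close>).

  A factorization through the \<open>d\<close>-dimensional \<open>\<ell>\<^sub>\<infinity>\<close> that approximates the shifted projections well
  provides \<open>d\<close> functionals of norm at most one, and for each word \<open>p\<close> one of them must be nearly \<open>n\<close>
  on the sum that belongs to \<open>p\<close>. But two distinct lines satisfy \<open>norm (y i + c *\<^sub>C y i') < 2\<close> for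
  all unimodular \<open>c\<close> (\<open>norm_projection_combination\<close>), so that at each site a functional of norm at
  most one can be nearly one in modulus on at most one of the \<open>k\<close> projections. Hence each functional serves few
  words. A Chernoff estimate makes this quantitative (\<open>card_le_CA_dimension\<close>): with an accuracy that
  depends on the chosen lines but not on \<open>n\<close>, it gives \<open>d \<ge> (k / (2 * e)) ^ n\<close>, where \<open>e\<close> is the base of the
  natural logarithm. So the entropy is at least \<open>ln k - ln 2 - 1\<close> for every \<open>k\<close>. One matrix factor
  of size at least two contains arbitrarily many lines, so this bound is unbounded.
\<close>

section \<open>A lower bound for CA entropy\<close>

lemma aligning_phase:
  fixes z w :: complex
  shows "\<exists>c. cmod c = 1 \<and> cmod (z + c * w) = cmod z + cmod w"
proof (cases "z = 0 \<or> w = 0")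
  case True
  then show ?thesis by (intro exI[of _ 1]) auto
next
  case False
  define c where "c = sgn z * cnj (sgn w)"
  have "z + c * w = sgn z * of_real (cmod z + cmod w)"
  proof -
    have "cnj (sgn w) * w = of_real (cmod w)"
      using False by (simp add: sgn_eq complex_norm_square[symmetric] power2_eq_square mult.commute)
    moreover have "z = sgn z * of_real (cmod z)"
      using False by (simp add: sgn_eq)
    ultimately show ?thesis by (simp add: c_def distrib_left mult.assoc)
  qed
  then have "cmod (z + c * w) = cmod z + cmod w"
    using False by (simp only: norm_mult norm_sgn norm_of_real) simp
  moreover have "cmod c = 1" using False by (simp add: c_def norm_mult norm_sgn)
  ultimately show ?thesis by blast
qed

text \<open>
  At most one \<open>b i\<close> exceeds \<open>1 - \<eta>\<close>. It contributes at most one, and the other terms are so small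
  that all of them together contribute at most one.
\<close>

lemma sum_exp_le_two:
  fixes b :: "nat \<Rightarrow> real"
  assumes le: "\<And>i. i < k \<Longrightarrow> b i \<le> 1"
    and sep: "\<And>i j. i < k \<Longrightarrow> j < k \<Longrightarrow> i \<noteq> j \<Longrightarrow> b i + b j \<le> 2 - 2 * \<eta>"
    and t: "0 \<le> t" "real k * exp (- (t * \<eta>)) \<le> 1"
  shows "(\<Sum>i<k. exp (t * (b i - 1))) \<le> 2"
proof -
  define A where "A = {i. i < k \<and> b i > 1 - \<eta>}"
  have A: "A \<subseteq> {..<k}" by (auto simp: A_def)
  have fA: "finite A" using A by (rule finite_subset) simp
  have "card A \<le> 1"
  proof (rule ccontr)
    assume "\<not> card A \<le> 1"
    then obtain i j where "i \<in> A" "j \<in> A" "i \<noteq> j"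
      using fA by (auto simp: card_le_Suc0_iff_eq)
    with sep[of i j] show False by (simp add: A_def)
  qed
  have "(\<Sum>i<k. exp (t * (b i - 1)))
      = (\<Sum>i\<in>{..<k} - A. exp (t * (b i - 1))) + (\<Sum>i\<in>A. exp (t * (b i - 1)))"
    by (rule sum.subset_diff[OF A]) simp
  also have "(\<Sum>i\<in>A. exp (t * (b i - 1))) \<le> (\<Sum>i\<in>A. 1)"
    using le t(1) by (intro sum_mono) (auto simp: A_def mult_nonneg_nonpos)
  also have "(\<Sum>i\<in>A. 1) \<le> (1::real)" using \<open>card A \<le> 1\<close> by simp
  also have "(\<Sum>i\<in>{..<k} - A. exp (t * (b i - 1))) \<le> (\<Sum>i\<in>{..<k} - A. exp (- (t * \<eta>)))"
  proof (rule sum_mono)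
    fix i assume "i \<in> {..<k} - A"
    then have "t * (b i - 1) \<le> t * (- \<eta>)"
      by (intro mult_left_mono t(1)) (auto simp: A_def)
    then show "exp (t * (b i - 1)) \<le> exp (- (t * \<eta>))" by simp
  qed
  also have "\<dots> \<le> (\<Sum>i<k. exp (- (t * \<eta>)))"
    by (rule sum_mono2) auto
  also have "\<dots> \<le> 1" using t(2) by simp
  finally show ?thesis by simp
qed

text \<open>
  The Chernoff estimate. The coordinates of \<open>\<phi>\<close> are \<open>d\<close> functionals of norm at most one. For each
  word \<open>p\<close> the norm of the sum along \<open>p\<close> survives the approximation up to \<open>n * \<delta>\<close>, so some
  coordinate detects \<open>p\<close>: its moduli \<open>b l j (p j)\<close> add up to at least \<open>n * (1 - \<delta>)\<close>. A
  detected word has exponential weight at least one after multiplication by \<open>exp (n * t * \<delta>)\<close>. The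
  total weight that one coordinate gives to all words factors over the sites, and each factor is at
  most two.
\<close>

lemma card_le_CA_dimension:
  fixes \<iota> :: "'a::complex_normed_vector \<Rightarrow> 'b::complex_normed_vector"
    and x :: "nat \<Rightarrow> nat \<Rightarrow> 'a"
  assumes \<iota>: "clinear \<iota>" "isometric \<iota>"
    and CA: "(\<phi>, \<psi>, d) \<in> CA \<iota> \<Omega> \<delta>"
    and x: "\<And>i j. i < k \<Longrightarrow> j < n \<Longrightarrow> x i j \<in> \<Omega>"
    and le1: "\<And>i j. i < k \<Longrightarrow> j < n \<Longrightarrow> norm (x i j) \<le> 1"
    and sep: "\<And>i i' j c. i < k \<Longrightarrow> i' < k \<Longrightarrow> i \<noteq> i' \<Longrightarrow> j < n \<Longrightarrow> cmod c = 1 \<Longrightarrow>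
        norm (x i j + c *\<^sub>C x i' j) \<le> 2 - 2 * \<eta>"
    and peak: "\<And>p. (\<And>j. j < n \<Longrightarrow> p j < k) \<Longrightarrow> real n \<le> norm (\<Sum>j<n. x (p j) j)"
    and t: "0 \<le> t" "real k * exp (- (t * \<eta>)) \<le> 1"
  shows "real k ^ n \<le> real d * (2 * exp (t * \<delta>)) ^ n"
proof -
  from CA have d: "d > 0" and \<phi>: "contraction_to_linf d \<phi>" and \<psi>: "contraction_from_linf d \<psi>"
    and app: "\<And>x. x \<in> \<Omega> \<Longrightarrow> norm (\<psi> (\<phi> x) - \<iota> x) < \<delta>"
    by (auto simp: CA_def)
  have \<phi>l: "cmod (\<phi> x l) \<le> norm x" if "l < d" for x l
    using \<phi> le_linf_norm[OF that, of "\<phi> x"] unfolding contraction_to_linf_def by (meson order_trans)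
  have \<phi>add: "\<phi> (x + y) l = \<phi> x l + \<phi> y l" and \<phi>scale: "\<phi> (c *\<^sub>C x) l = c * \<phi> x l" for x y c l
    using \<phi> by (auto simp: contraction_to_linf_def)
  have \<phi>0: "\<phi> 0 l = 0" for l using \<phi>scale[of 0 0 l] by simp
  have \<phi>sum: "\<phi> (\<Sum>j\<in>J. f j) l = (\<Sum>j\<in>J. \<phi> (f j) l)" for J :: "nat set" and f l
    by (induct J rule: infinite_finite_induct) (auto simp: \<phi>0 \<phi>add)
  define D where "D = (\<lambda>x. \<psi> (\<phi> x) - \<iota> x)"
  \<comment> \<open>The error is additive because \<open>\<phi>\<close> maps into \<open>linf d\<close>, where \<open>\<psi>\<close> is linear, so an error
    below \<open>\<delta>\<close> on each \<open>x i j\<close> bounds the error on a sum along a word.\<close>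
  have Dadd: "D (x + y) = D x + D y" for x y
  proof -
    have "\<phi> x \<in> linf d" "\<phi> y \<in> linf d" "\<phi> (x + y) = (\<lambda>i. \<phi> x i + \<phi> y i)"
      using \<phi> by (auto simp: contraction_to_linf_def)
    then have "\<psi> (\<phi> (x + y)) = \<psi> (\<phi> x) + \<psi> (\<phi> y)"
      using \<psi> by (simp add: contraction_from_linf_def)
    then show ?thesis using \<iota>(1) by (simp add: D_def clinear_def)
  qed
  have D0: "D 0 = 0" using Dadd[of 0 0] by simp
  have Dsum: "D (\<Sum>j\<in>J. f j) = (\<Sum>j\<in>J. D (f j))" for J :: "nat set" and f
    by (induct J rule: infinite_finite_induct) (auto simp: D0 Dadd)
  define b where "b = (\<lambda>l j i. cmod (\<phi> (x i j) l))"
  define P where "P = PiE {..<n} (\<lambda>_. {..<k})"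
  have finP: "finite P" unfolding P_def by (intro finite_PiE) auto
  have detect: "\<exists>l<d. real n * (1 - \<delta>) \<le> (\<Sum>j<n. b l j (p j))" if p: "p \<in> P" for p
  proof -
    have pk: "p j < k" if "j < n" for j using p that by (auto simp: P_def)
    define S where "S = (\<Sum>j<n. x (p j) j)"
    have "norm (D S) \<le> (\<Sum>j<n. norm (D (x (p j) j)))"
      unfolding S_def Dsum by (rule norm_sum)
    also have "\<dots> \<le> (\<Sum>j<n. \<delta>)"
      by (intro sum_mono) (use app x pk in \<open>auto simp: D_def intro: less_imp_le\<close>)
    finally have DS: "norm (D S) \<le> real n * \<delta>" by simp
    have "real n \<le> norm (\<iota> S)" using peak[of p] pk \<iota>(2) by (simp add: S_def isometric_def)
    also have "\<iota> S = \<psi> (\<phi> S) - D S" by (simp add: D_def)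
    also have "norm \<dots> \<le> norm (\<psi> (\<phi> S)) + norm (D S)" by (rule norm_triangle_ineq4)
    also have "norm (\<psi> (\<phi> S)) \<le> linf_norm d (\<phi> S)"
      using \<psi> \<phi> by (auto simp: contraction_from_linf_def contraction_to_linf_def)
    finally have lower: "real n * (1 - \<delta>) \<le> linf_norm d (\<phi> S)" using DS by (simp add: algebra_simps)
    have "linf_norm d (\<phi> S) \<in> (\<lambda>l. cmod (\<phi> S l)) ` {..<d}"
      unfolding linf_norm_def using d by (intro Max_in) auto
    then obtain l where l: "l < d" "linf_norm d (\<phi> S) = cmod (\<phi> S l)" by auto
    have "cmod (\<phi> S l) \<le> (\<Sum>j<n. b l j (p j))"
      unfolding S_def \<phi>sum b_def by (rule norm_sum)
    with l lower show ?thesis by auto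
  qed
  have row: "(\<Sum>i<k. exp (t * (b l j i - 1))) \<le> 2" if lj: "l < d" "j < n" for l j
  proof (rule sum_exp_le_two[OF _ _ t])
    show "b l j i \<le> 1" if "i < k" for i
      using \<phi>l[OF lj(1), of "x i j"] le1[OF that lj(2)] by (simp add: b_def)
    show "b l j i + b l j i' \<le> 2 - 2 * \<eta>" if i: "i < k" "i' < k" "i \<noteq> i'" for i i'
    proof -
      \<comment> \<open>With aligned phases the two moduli add up to the modulus of a single value of coordinate \<open>l\<close>.\<close>
      obtain c where c: "cmod c = 1" "cmod (\<phi> (x i j) l + c * \<phi> (x i' j) l) = b l j i + b l j i'"
        unfolding b_def using aligning_phase by blast
      then have "b l j i + b l j i' = cmod (\<phi> (x i j + c *\<^sub>C x i' j) l)" by (simp add: \<phi>add \<phi>scale)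
      also have "\<dots> \<le> 2 - 2 * \<eta>"
        using \<phi>l[OF lj(1)] sep[OF i lj(2) c(1)] by (rule order_trans)
      finally show ?thesis .
    qed
  qed
  have "real k ^ n = (\<Sum>p\<in>P. 1)" by (simp add: P_def card_PiE)
  also have "\<dots> \<le> (\<Sum>p\<in>P. exp (t * \<delta>) ^ n * (\<Sum>l<d. \<Prod>j<n. exp (t * (b l j (p j) - 1))))"
  proof (rule sum_mono)
    fix p assume "p \<in> P"
    then obtain l where l: "l < d" "real n * (1 - \<delta>) \<le> (\<Sum>j<n. b l j (p j))" using detect by blast
    have "0 \<le> t * (real n * \<delta> + (\<Sum>j<n. b l j (p j) - 1))"
      using l(2) t(1) by (intro mult_nonneg_nonneg) (auto simp: sum_subtractf algebra_simps)
    also have "\<dots> = real n * (t * \<delta>) + (\<Sum>j<n. t * (b l j (p j) - 1))"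
      by (simp add: sum_distrib_left distrib_left)
    finally have "1 \<le> exp (real n * (t * \<delta>) + (\<Sum>j<n. t * (b l j (p j) - 1)))" by simp
    also have "\<dots> = exp (t * \<delta>) ^ n * (\<Prod>j<n. exp (t * (b l j (p j) - 1)))"
      by (simp add: exp_add exp_sum exp_of_nat_mult)
    also have "\<dots> \<le> exp (t * \<delta>) ^ n * (\<Sum>l<d. \<Prod>j<n. exp (t * (b l j (p j) - 1)))"
      using l(1) by (intro mult_left_mono member_le_sum[where f = "\<lambda>l. \<Prod>j<n. exp (t * (b l j (p j) - 1))"])
        (auto intro: prod_nonneg)
    finally show "1 \<le> exp (t * \<delta>) ^ n * (\<Sum>l<d. \<Prod>j<n. exp (t * (b l j (p j) - 1)))" .
  qed
  also have "\<dots> = exp (t * \<delta>) ^ n * (\<Sum>l<d. \<Sum>p\<in>P. \<Prod>j<n. exp (t * (b l j (p j) - 1)))"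
    by (subst sum.swap) (simp add: sum_distrib_left)
  also have "\<dots> = exp (t * \<delta>) ^ n * (\<Sum>l<d. \<Prod>j<n. \<Sum>i<k. exp (t * (b l j i - 1)))"
    unfolding P_def by (subst prod_sum_PiE) auto
  also have "\<dots> \<le> exp (t * \<delta>) ^ n * (\<Sum>l<d. \<Prod>j<n. 2)"
    using row by (intro mult_left_mono sum_mono prod_mono) (auto intro: sum_nonneg)
  also have "\<dots> = real d * (2 * exp (t * \<delta>)) ^ n" by (simp add: power_mult_distrib)
  finally show ?thesis .
qed

text \<open>
  The bound on \<open>d\<close> is used with \<open>t\<close> so large that \<open>k * exp (- t * \<eta>) \<le> 1\<close> and with accuracy \<open>1 / t\<close>.
  Both are independent of \<open>n\<close>, and the loss \<open>exp (t * \<delta>)\<close> per site becomes the constant \<open>exp 1\<close>.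
\<close>

lemma hc_ge_of_peaking_orbits:
  fixes \<iota> :: "'a::complex_banach \<Rightarrow> 'b::complex_banach" and \<alpha> :: "'a \<Rightarrow> 'a"
  assumes \<iota>: "CA_embedding \<iota>" and \<alpha>: "clinear \<alpha>" "isometric \<alpha>"
    and k: "0 < k"
    and le1: "\<And>i. i < k \<Longrightarrow> norm (y i) \<le> 1"
    and r: "r < 2"
    and sep: "\<And>i i' c. i < k \<Longrightarrow> i' < k \<Longrightarrow> i \<noteq> i' \<Longrightarrow> cmod c = 1 \<Longrightarrow>
        norm (y i + c *\<^sub>C y i') \<le> r"
    and peak: "\<And>n p. (\<And>j. p j < k) \<Longrightarrow> real n \<le> norm (\<Sum>j<n. (\<alpha> ^^ j) (y (p j)))"
  shows "ereal (ln (real k) - (1 + ln 2)) \<le> hc \<iota> \<alpha>"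
proof -
  define \<eta> where "\<eta> = (2 - r) / 2"
  have \<eta>: "\<eta> > 0" "r = 2 - 2 * \<eta>" using r by (simp_all add: \<eta>_def field_simps)
  \<comment> \<open>The summand 1 keeps \<open>t\<close>, and with it the accuracy \<open>1 / t\<close>, positive when \<open>k = 1\<close>.\<close>
  define t where "t = ln (real k) / \<eta> + 1"
  have t: "t > 0" using k \<eta> by (auto simp: t_def intro!: add_nonneg_pos divide_nonneg_pos)
  have "t * \<eta> = ln (real k) + \<eta>" using \<eta>(1) by (simp add: t_def distrib_right)
  then have "real k * exp (- (t * \<eta>)) = exp (- \<eta>)"
    using k by (simp add: exp_diff exp_minus exp_add divide_inverse)
  then have kt: "real k * exp (- (t * \<eta>)) \<le> 1" using \<eta> by simp
  define \<Omega> where "\<Omega> = y ` {..<k}"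
  let ?O = "\<lambda>n. \<Union>j<n. (\<alpha> ^^ j) ` \<Omega>"
  have iso: "norm ((\<alpha> ^^ j) x) = norm x" for j x
    by (induct j) (use \<alpha>(2) in \<open>auto simp: isometric_def\<close>)
  have lin: "(\<alpha> ^^ j) (x + c *\<^sub>C z) = (\<alpha> ^^ j) x + c *\<^sub>C (\<alpha> ^^ j) z" for j x c z
    by (induct j) (use \<alpha>(1) in \<open>auto simp: clinear_def\<close>)
  have bound: "ln (real k) - (1 + ln 2) \<le> 1 / real n * ln (real (rc \<iota> (?O n) (1 / t)))" if n: "n > 0" for n
  proof -
    have "CA \<iota> (?O n) (1 / t) \<noteq> {}"
      using \<iota> t by (auto simp: CA_embedding_def \<Omega>_def)
    then have "rc \<iota> (?O n) (1 / t) \<in> (\<lambda>(\<phi>, \<psi>, d). d) ` CA \<iota> (?O n) (1 / t)"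
      unfolding rc_def by (intro Inf_nat_def1) auto
    then obtain \<phi> \<psi> where CA: "(\<phi>, \<psi>, rc \<iota> (?O n) (1 / t)) \<in> CA \<iota> (?O n) (1 / t)" by auto
    define d where "d = rc \<iota> (?O n) (1 / t)"
    have d: "d > 0" using CA by (simp add: CA_def d_def)
    have "real k ^ n \<le> real d * (2 * exp (t * (1 / t))) ^ n"
    proof (rule card_le_CA_dimension[where x = "\<lambda>i j. (\<alpha> ^^ j) (y i)"])
      show "clinear \<iota>" "isometric \<iota>" using \<iota> by (auto simp: CA_embedding_def)
      show "(\<phi>, \<psi>, d) \<in> CA \<iota> (?O n) (1 / t)" using CA by (simp add: d_def)
      \<comment> \<open>A word of length \<open>n\<close> is continued by the letter 0.\<close>
      show "real n \<le> norm (\<Sum>j<n. (\<alpha> ^^ j) (y (p j)))" if "\<And>j. j < n \<Longrightarrow> p j < k" for p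
        using peak[of "\<lambda>j. if j < n then p j else 0" n] that k by simp
      show "norm ((\<alpha> ^^ j) (y i) + c *\<^sub>C (\<alpha> ^^ j) (y i')) \<le> 2 - 2 * \<eta>"
        if "i < k" "i' < k" "i \<noteq> i'" "j < n" "cmod c = 1" for i i' j c
        using sep[OF that(1-3,5)] by (simp add: iso \<eta>(2) flip: lin)
    qed (use t kt le1 in \<open>auto simp: \<Omega>_def iso\<close>)
    then have "ln (real k ^ n) \<le> ln (real d * (2 * exp 1) ^ n)"
      using k t by (subst ln_le_cancel_iff) (auto simp: d)
    also have "\<dots> = ln (real d) + real n * (1 + ln 2)"
      using d by (simp add: ln_mult ln_realpow distrib_left)
    finally have "real n * (ln (real k) - (1 + ln 2)) \<le> ln (real d)"
      using k by (simp add: ln_realpow algebra_simps)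
    then show ?thesis using n by (simp add: d_def field_simps)
  qed
  have "ereal (ln (real k) - (1 + ln 2)) \<le> hc_at \<iota> \<alpha> \<Omega> (1 / t)"
    unfolding hc_at_def
  proof (rule le_Limsup)
    show "\<forall>\<^sub>F n in sequentially. ereal (ln (real k) - (1 + ln 2))
        \<le> ereal (1 / real n * ln (real (rc \<iota> (?O n) (1 / t))))"
      using eventually_gt_at_top[of 0] by eventually_elim (use bound in simp)
  qed simp
  also have "\<dots> \<le> (SUP \<delta> \<in> {0<..}. hc_at \<iota> \<alpha> \<Omega> \<delta>)"
    using t by (intro SUP_upper) simp
  also have "\<dots> \<le> hc \<iota> \<alpha>"
    unfolding hc_def by (intro SUP_upper) (simp add: \<Omega>_def)
  finally show ?thesis .
qed

section \<open>Rank-one projections in a tensor factor\<close>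

definition line_proj :: "real^'n \<Rightarrow> complex^'n^'n" where
  "line_proj u = (\<chi> i j. of_real (u $ i * u $ j))"

lemma line_proj_sandwich:
  "line_proj u ** line_proj v ** line_proj u = (u \<bullet> v)\<^sup>2 *\<^sub>R line_proj u"
proof -
  have "(\<Sum>l\<in>UNIV. (\<Sum>h\<in>UNIV. u $ i * u $ h * (v $ h * v $ l)) * (u $ l * u $ j))
      = (u \<bullet> v)\<^sup>2 * (u $ i * u $ j)" for i j
  proof -
    have "(\<Sum>l\<in>UNIV. (\<Sum>h\<in>UNIV. u $ i * u $ h * (v $ h * v $ l)) * (u $ l * u $ j))
        = (\<Sum>l\<in>UNIV. (u $ i * u $ j) * (\<Sum>h\<in>UNIV. u $ h * v $ h) * (u $ l * v $ l))"
      by (simp add: sum_distrib_left sum_distrib_right mult_ac)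
    also have "\<dots> = (u $ i * u $ j) * (\<Sum>h\<in>UNIV. u $ h * v $ h) * (\<Sum>l\<in>UNIV. u $ l * v $ l)"
      by (simp add: sum_distrib_left)
    finally show ?thesis by (simp add: inner_vec_def power2_eq_square mult_ac)
  qed
  then show ?thesis
    unfolding line_proj_def matrix_matrix_mult_def
    by (simp only: vec_eq_iff vec_lambda_beta vector_scaleR_component
        scaleR_conv_of_real[where 'a = complex] of_real_mult[symmetric] of_real_sum[symmetric] simp_thms)
qed

lemma line_proj_idem: "norm u = 1 \<Longrightarrow> line_proj u ** line_proj u = line_proj u"
proof -
  assume u: "norm u = 1"
  have "(\<Sum>h\<in>UNIV. u $ i * u $ h * (u $ h * u $ j)) = u $ i * u $ j" for i j
  proof -
    have "(\<Sum>h\<in>UNIV. u $ i * u $ h * (u $ h * u $ j)) = (u $ i * u $ j) * (u \<bullet> u)"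
      by (simp add: inner_vec_def sum_distrib_left mult_ac)
    then show ?thesis using u by (simp add: dot_square_norm)
  qed
  then show ?thesis
    unfolding line_proj_def matrix_matrix_mult_def
    by (simp only: vec_eq_iff vec_lambda_beta
        of_real_mult[symmetric] of_real_sum[symmetric] simp_thms)
qed

lemma local_site_scaleR: "local_site k (r *\<^sub>R m) = r *\<^sub>R local_site k m"
  unfolding scaleR_scaleC
  by transfer (auto simp: local_matrix_def fun_eq_iff scaleR_conv_of_real[where 'a = complex])

lemma star_local_site_line_proj: "star (local_site k (line_proj u)) = local_site k (line_proj u)"
  unfolding local_site_hom(4)[symmetric]
  by (rule arg_cong[of _ _ "local_site k"]) (simp add: line_proj_def vec_eq_iff mult.commute)

lemma norm_projection_le_1:
  fixes P :: "'a::pre_cstar_algebra"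
  assumes "star P = P" "P * P = P"
  shows "norm P \<le> 1"
proof -
  have "norm P * norm P = norm P" using cstar_identity[of P] assms by (simp add: power2_eq_square)
  then show ?thesis by (cases "norm P = 0") auto
qed

text \<open>
  By the C*-identity, the squared norm is that of \<open>P + Q + c *\<^sub>C (P * Q) + cnj c *\<^sub>C (Q * P)\<close>, while
  \<open>P * Q * P = s\<^sup>2 *\<^sub>R P\<close> forces \<open>P * Q\<close> and \<open>Q * P\<close> to have norm at most \<open>\<bar>s\<bar>\<close>. For the projections
  onto two lines, \<open>s\<close> is the inner product of unit vectors that span them, so the bound is below 2
  when the lines are distinct.
\<close>

lemma norm_projection_combination:
  fixes P Q :: "'a::pre_cstar_algebra"
  assumes P: "star P = P" "P * P = P" and Q: "star Q = Q" "Q * Q = Q"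
    and PQP: "P * Q * P = s\<^sup>2 *\<^sub>R P" and c: "cmod c = 1"
  shows "norm (P + c *\<^sub>C Q) \<le> sqrt (2 + 2 * \<bar>s\<bar>)"
proof -
  have nP: "norm P \<le> 1" and nQ: "norm Q \<le> 1" by (rule norm_projection_le_1; fact)+
  have "(norm (Q * P))\<^sup>2 = norm (star (Q * P) * (Q * P))" by (rule cstar_identity[symmetric])
  also have "star (Q * P) * (Q * P) = P * (Q * Q) * P" by (simp add: star_mult P(1) Q(1) mult.assoc)
  also have "norm \<dots> = s\<^sup>2 * norm P" by (simp add: PQP Q)
  also have "\<dots> \<le> \<bar>s\<bar>\<^sup>2" using nP by (simp add: mult_left_le)
  finally have QP: "norm (Q * P) \<le> \<bar>s\<bar>" by (rule power2_le_imp_le) simp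
  have "norm (P * Q) = norm (star (P * Q))" by (simp add: norm_star)
  then have PQ: "norm (P * Q) \<le> \<bar>s\<bar>" using QP by (simp add: star_mult P Q)
  have cc: "cnj c * c = 1" using c by (simp add: complex_norm_square[symmetric] mult.commute)
  have "star (P + c *\<^sub>C Q) * (P + c *\<^sub>C Q) = P + Q + c *\<^sub>C (P * Q) + cnj c *\<^sub>C (Q * P)"
    by (simp add: star_add star_scaleC P Q distrib_left distrib_right mult_scaleC_left
        mult_scaleC_right scaleC_scaleC scaleC_add_right cc mult.commute[of c])
  then have "(norm (P + c *\<^sub>C Q))\<^sup>2 = norm (P + Q + c *\<^sub>C (P * Q) + cnj c *\<^sub>C (Q * P))"
    by (simp add: cstar_identity[symmetric])
  also have "\<dots> \<le> norm P + norm Q + norm (c *\<^sub>C (P * Q)) + norm (cnj c *\<^sub>C (Q * P))"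
    by (intro norm_triangle_le add_right_mono order_refl norm_triangle_ineq)
  also have "\<dots> \<le> 2 + 2 * \<bar>s\<bar>" using nP nQ PQ QP c by (simp add: norm_scaleC)
  finally show ?thesis by (rule real_le_rsqrt)
qed

text \<open>
  The element \<open>E\<close> is the product of the commuting projections, so each of them fixes it. It is
  nonzero because its diagonal entry at the constant configuration is a product of diagonal entries of the
  factors. The induction keeps track of the sites through \<open>supported\<close>: the next factor acts at a new site, so
  only the diagonal term survives in the product of matrices.
\<close>

lemma common_fixed_element:
  fixes u :: "nat \<Rightarrow> real^('n::finite)"
  assumes u: "\<And>j. norm (u j) = 1" and a: "\<And>j. u j $ a \<noteq> 0"
  shows "\<exists>E :: 'n local_algebra. supported {0..<int n} (entries E) \<and> entries E (\<lambda>_. a) (\<lambda>_. a) \<noteq> 0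
    \<and> (\<forall>j<n. local_site (int j) (line_proj (u j)) * E = E)"
proof (induct n)
  case 0
  show ?case
    by (rule exI[of _ 1]) (simp add: one_local_algebra.rep_eq supported_one)
next
  case (Suc n)
  then obtain E :: "'n local_algebra" where E: "supported {0..<int n} (entries E)"
    "entries E (\<lambda>_. a) (\<lambda>_. a) \<noteq> 0"
    "\<And>j. j < n \<Longrightarrow> local_site (int j) (line_proj (u j)) * E = E" by blast
  let ?p = "\<lambda>j. local_site (int j) (line_proj (u j))"
  let ?a = "\<lambda>_ :: int. a"
  let ?m = "entries (?p n)"
  have m: "?m = local_matrix {int n} (\<lambda>s t. line_proj (u n) $ s (int n) $ t (int n))"
    by (rule local_site.rep_eq)
  have sm: "supported {int n} ?m" unfolding m by (rule supported_site)
  have "supported {0..<int (Suc n)} (entries (?p n * E))"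
    unfolding times_local_algebra.rep_eq
    by (intro supported_mult supported_mono[OF sm] supported_mono[OF E(1)]) auto
  moreover have "entries (?p n * E) ?a ?a \<noteq> 0"
  proof -
    have "entries (?p n * E) ?a ?a = (\<Sum>v\<in>nbhd {int n} ?a. ?m ?a v * entries E v ?a)"
      unfolding times_local_algebra.rep_eq by (rule mat_mult_eq[OF sm])
    also have "\<dots> = (\<Sum>v\<in>{?a}. ?m ?a v * entries E v ?a)"
    proof (rule sum.mono_neutral_right)
      show "finite (nbhd {int n} ?a)" by (simp add: finite_nbhd)
      show "\<forall>v\<in>nbhd {int n} ?a - {?a}. ?m ?a v * entries E v ?a = 0"
      proof
        fix v assume v: "v \<in> nbhd {int n} ?a - {?a}"
        \<comment> \<open>Such \<open>v\<close> differs from the constant configuration at site \<open>n\<close>, where \<open>E\<close> is the identity.\<close>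
        then have "v (int n) \<noteq> a" by (auto simp: nbhd_def fun_eq_iff) metis
        then have "?a \<notin> nbhd {0..<int n} v" by (auto simp: nbhd_def)
        then show "?m ?a v * entries E v ?a = 0" using supported_0[OF E(1)] by simp
      qed
    qed simp
    also have "\<dots> = ?m ?a ?a * entries E ?a ?a" by simp
    also have "?m ?a ?a = of_real (u n $ a * u n $ a)"
      unfolding m by (simp add: local_matrix_def line_proj_def)
    finally show ?thesis using a E(2) by simp
  qed
  moreover have "?p j * (?p n * E) = ?p n * E" if "j < Suc n" for j
  proof (cases "j = n")
    case True
    then show ?thesis
      by (simp add: mult.assoc[symmetric] local_site_hom(2)[symmetric] line_proj_idem u)
  next
    case False
    then have "?p j * (?p n * E) = ?p n * (?p j * E)"
      by (metis local_site_commute mult.assoc of_nat_eq_iff)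
    then show ?thesis using E(3) False that by simp
  qed
  ultimately show ?case by blast
qed

lemma norm_sum_of_projections_at_distinct_sites:
  fixes u :: "nat \<Rightarrow> real^('n::finite)"
  assumes "\<And>j. norm (u j) = 1" "\<And>j. u j $ a \<noteq> 0"
  shows "real n \<le> norm (\<Sum>j<n. local_site (int j) (line_proj (u j)))"
proof -
  obtain E :: "'n local_algebra" where E: "entries E (\<lambda>_. a) (\<lambda>_. a) \<noteq> 0"
    "\<And>j. j < n \<Longrightarrow> local_site (int j) (line_proj (u j)) * E = E"
    using common_fixed_element[of u a n, OF assms] by blast
  have "E \<noteq> 0" using E(1) by (auto simp: zero_local_algebra.rep_eq)
  have "(\<Sum>j<n. local_site (int j) (line_proj (u j))) * E = real n *\<^sub>R E"
    using E(2) by (simp add: sum_distrib_right scaleR_conv_of_real)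
  then have "real n * norm E \<le> norm (\<Sum>j<n. local_site (int j) (line_proj (u j))) * norm E"
    using norm_mult_ineq[of "\<Sum>j<n. local_site (int j) (line_proj (u j))" E] by simp
  then show ?thesis using \<open>E \<noteq> 0\<close> by simp
qed

section \<open>The tensor product shift\<close>

lemma funpow_tensor_shift_site: "(tensor_shift ^^ j) (site k m) = site (k + int j) m"
  by (induct j) (auto simp: tensor_shift_site add_ac)

lemma to_completion_sum: "to_completion (\<Sum>j\<in>J. f j) = (\<Sum>j\<in>J. to_completion (f j))"
proof (induct J rule: infinite_finite_induct)
  have "to_completion (0 :: 'a) = 0" using to_completion_diff[of "0::'a" 0] by simp
  then show "\<And>A. infinite A \<Longrightarrow> to_completion (sum f A) = (\<Sum>j\<in>A. to_completion (f j))"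
    "to_completion (sum f {}) = (\<Sum>j\<in>{}. to_completion (f j))" by simp_all
qed (simp add: to_completion_hom)

text \<open>
  The vectors are \<open>(1, i)\<close> in a fixed coordinate plane, normalized. The common coordinate \<open>a\<close> where none of
  them vanishes gives the nonzero entry required by \<open>common_fixed_element\<close>.
\<close>

lemma separated_unit_vectors:
  assumes "CARD('n::finite) \<ge> 2"
  shows "\<exists>(u :: nat \<Rightarrow> real^'n) a. (\<forall>i. norm (u i) = 1 \<and> u i $ a \<noteq> 0)
    \<and> (\<forall>i j. i \<noteq> j \<longrightarrow> \<bar>u i \<bullet> u j\<bar> < 1)"
proof -
  obtain a b :: 'n where ab: "a \<noteq> b"
    using assms card_le_Suc0_iff_eq[of "UNIV :: 'n set"] by fastforce
  define w :: "nat \<Rightarrow> real^'n" where "w = (\<lambda>i. axis a 1 + real i *\<^sub>R axis b 1)"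
  have ip: "w i \<bullet> w j = 1 + real i * real j" for i j
    using ab by (simp add: w_def inner_add_left inner_add_right inner_axis_axis)
  have w0: "w i \<noteq> 0" for i
    using ip[of i i] by (metis add_pos_nonneg inner_zero_left less_irrefl zero_less_one mult_nonneg_nonneg of_nat_0_le_iff)
  have wa: "w i $ a = 1" for i using ab by (simp add: w_def axis_def)
  define u where "u = (\<lambda>i. w i /\<^sub>R norm (w i))"
  have nu: "norm (u i) = 1" for i using w0 by (simp add: u_def)
  have "\<bar>u i \<bullet> u j\<bar> < 1" if ij: "i \<noteq> j" for i j
  proof (rule ccontr)
    assume "\<not> ?thesis"
    then have "\<bar>u i \<bullet> u j\<bar> = norm (u i) * norm (u j)"
      using Cauchy_Schwarz_ineq2[of "u i" "u j"] nu by simp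
    then have "\<bar>w i \<bullet> w j\<bar> = norm (w i) * norm (w j)"
      using w0 by (simp add: u_def abs_mult divide_simps)
    then have "\<bar>w i \<bullet> w j\<bar>\<^sup>2 = (norm (w i) * norm (w j))\<^sup>2" by simp
    then have "(w i \<bullet> w j)\<^sup>2 = (w i \<bullet> w i) * (w j \<bullet> w j)"
      by (simp add: power_mult_distrib dot_square_norm)
    then have "(real i - real j)\<^sup>2 = 0" unfolding ip by (simp add: power2_eq_square algebra_simps)
    with ij show False by simp
  qed
  moreover have "u i $ a \<noteq> 0" for i using w0 wa by (simp add: u_def)
  ultimately show ?thesis using nu by blast
qed

lemma hc_tensor_shift_ge:
  fixes \<iota> :: "('n::finite) uhf \<Rightarrow> 'y::complex_banach"
  assumes "CARD('n) \<ge> 2" "CA_embedding \<iota>" "0 < k"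
  shows "ereal (ln (real k) - (1 + ln 2)) \<le> hc \<iota> (tensor_shift :: 'n uhf \<Rightarrow> 'n uhf)"
proof -
  obtain u :: "nat \<Rightarrow> real^'n" and a where u: "\<And>i. norm (u i) = 1" "\<And>i. u i $ a \<noteq> 0"
    "\<And>i j. i \<noteq> j \<Longrightarrow> \<bar>u i \<bullet> u j\<bar> < 1" using separated_unit_vectors[OF assms(1)] by blast
  let ?p = "\<lambda>i. local_site 0 (line_proj (u i))"
  have idem: "?p i * ?p i = ?p i" for i
    by (simp add: local_site_hom(2)[symmetric] line_proj_idem u)
  have pqp: "?p i * ?p j * ?p i = (u i \<bullet> u j)\<^sup>2 *\<^sub>R ?p i" for i j
    by (simp add: local_site_hom(2)[symmetric] local_site_scaleR[symmetric] line_proj_sandwich)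
  \<comment> \<open>The finitely many bounds for pairs of lines have a maximum below 2. The element 0 makes the
    set nonempty when \<open>k = 1\<close>.\<close>
  define R where "R = insert 0 ((\<lambda>(i, j). sqrt (2 + 2 * \<bar>u i \<bullet> u j\<bar>)) ` {(i, j). i < k \<and> j < k \<and> i \<noteq> j})"
  have "{(i, j). i < k \<and> j < k \<and> i \<noteq> j} \<subseteq> {..<k} \<times> {..<k}" by auto
  then have finR: "finite R" unfolding R_def by (meson finite.insertI finite_SigmaI finite_imageI finite_lessThan finite_subset)
  have "sqrt (2 + 2 * \<bar>u i \<bullet> u j\<bar>) < 2" if "i \<noteq> j" for i j
    using u(3)[OF that] by (intro real_less_lsqrt) auto
  then have "Max R < 2" using finR by (subst Max_less_iff) (auto simp: R_def)
  have "clinear (tensor_shift :: 'n uhf \<Rightarrow> _)" "isometric (tensor_shift :: 'n uhf \<Rightarrow> _)"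
    using isometric_automorphism_tensor_shift by (auto simp: isometric_automorphism_def)
  then show ?thesis
  proof (rule hc_ge_of_peaking_orbits[OF assms(2) _ _ assms(3), where y = "\<lambda>i. site 0 (line_proj (u i))"])
    show "norm (site 0 (line_proj (u i))) \<le> 1" for i
      using norm_projection_le_1[OF star_local_site_line_proj idem] by (simp add: site_def norm_to_completion)
    show "Max R < 2" by fact
    show "norm (site 0 (line_proj (u i)) + c *\<^sub>C site 0 (line_proj (u j))) \<le> Max R"
      if "i < k" "j < k" "i \<noteq> j" "cmod c = 1" for i j c
    proof -
      have "norm (?p i + c *\<^sub>C ?p j) \<le> sqrt (2 + 2 * \<bar>u i \<bullet> u j\<bar>)"
        by (rule norm_projection_combination[OF _ _ _ _ pqp that(4)])
           (simp_all add: star_local_site_line_proj idem)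
      also have "\<dots> \<le> Max R" using that finR by (intro Max_ge) (auto simp: R_def)
      finally show ?thesis
        by (simp add: site_def norm_to_completion flip: to_completion_hom)
    qed
    show "real n \<le> norm (\<Sum>j<n. (tensor_shift ^^ j) (site 0 (line_proj (u (p j)))))" for n p
      using norm_sum_of_projections_at_distinct_sites[of "\<lambda>j. u (p j)" a n] u
      by (simp add: funpow_tensor_shift_site) (simp add: site_def norm_to_completion flip: to_completion_sum)
  qed
qed

theorem theorem9p3:
  fixes \<iota> :: "('n::finite) uhf \<Rightarrow> 'y::complex_banach"
  assumes "CARD('n) \<ge> 2"
    and "CA_embedding \<iota>"
  shows "hc \<iota> (tensor_shift :: 'n uhf \<Rightarrow> 'n uhf) = \<infinity>"
proof (rule ereal_top)
  fix B :: real
  obtain k :: nat where k: "exp (B + 1 + ln 2) \<le> real k" using real_arch_simple by blast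
  then have "0 < real k" using exp_gt_zero less_le_trans by blast
  then have "B \<le> ln (real k) - (1 + ln 2)" using k ln_ge_iff[of "real k" "B + 1 + ln 2"] by simp
  then have "ereal B \<le> ereal (ln (real k) - (1 + ln 2))" by simp
  also have "\<dots> \<le> hc \<iota> (tensor_shift :: 'n uhf \<Rightarrow> 'n uhf)"
    using hc_tensor_shift_ge[OF assms] \<open>0 < real k\<close> by simp
  finally show "ereal B \<le> hc \<iota> (tensor_shift :: 'n uhf \<Rightarrow> 'n uhf)" .
qed

end
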